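(* There exists a zero-dimensional $F$-space that is not strongly zero-dimensional. That is, there is a Tychonoff space $X$ such that $X$ is zero-dimensional, $X$ is an $F$-space, and the Čech–Stone compactification $\beta X$ is not zero-dimensional.
   Context: A topological space is zero-dimensional if it is a $T_1$-space and its clopen subsets form a base for its topology. A Tychonoff space $X$ is strongly zero-dimensional if any two completely separated subsets are separated by a clopen set: whenever $A,B\subseteq X$ and there is a continuous $f:X\to[-1,1]$ with $f[A]=\{-1\}$ and $f[B]=\{1\}$, there is a clopen set $C\subseteq X$ with $A\subseteq C$ and $C\cap B=\emptyset$; equivalently, $\beta X$ is zero-dimensional. A Tychonoff space $X$ is an $F$-space if for every continuous $f:X\to\mathbb{R}$ there is a continuous $k:X\to\mathbb{R}$ such that $f=k\cdot|f|$. The existence is asserted in $\mathsf{ZFC}$, with no additional set-theoretic assumptions. *)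

theory Defs
  imports "HOL-Analysis.Analysis"
begin

definition tychonoff_space :: "'a topology \<Rightarrow> bool" where
  "tychonoff_space X \<longleftrightarrow> completely_regular_space X \<and> t1_space X"

definition zero_dimensional_space :: "'a topology \<Rightarrow> bool" where
  "zero_dimensional_space X \<longleftrightarrow>
     t1_space X \<and> openin X = arbitrary union_of (\<lambda>C. openin X C \<and> closedin X C)"

definition completely_separated :: "'a topology \<Rightarrow> 'a set \<Rightarrow> 'a set \<Rightarrow> bool" where
  "completely_separated X A B \<longleftrightarrow>
     (\<exists>f. continuous_map X (top_of_set {-1..1::real}) f \<and> f ` A = {-1} \<and> f ` B = {1})"

text \<open>The next two notions are only meant for Tychonoff spaces; that assumption is not part of
  the predicates, so that negating one of them does not negate it.\<close>

definition strongly_zero_dimensional :: "'a topology \<Rightarrow> bool" where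
  "strongly_zero_dimensional X \<longleftrightarrow>
     (\<forall>A B. A \<subseteq> topspace X \<and> B \<subseteq> topspace X \<and> completely_separated X A B \<longrightarrow>
        (\<exists>C. openin X C \<and> closedin X C \<and> A \<subseteq> C \<and> C \<inter> B = {}))"

definition F_space :: "'a topology \<Rightarrow> bool" where
  "F_space X \<longleftrightarrow>
     (\<forall>f. continuous_map X euclideanreal f \<longrightarrow>
        (\<exists>k. continuous_map X euclideanreal k \<and> (\<forall>x \<in> topspace X. f x = k x * \<bar>f x\<bar>)))"

text \<open>The Cech-Stone compactification, as the closure of the image of \<open>X\<close> under the evaluation
  map into the cube \<open>[0,1]\<^bsup>C(X,[0,1])\<^esup>\<close>. Extensionality makes each element of \<open>C(X,[0,1])\<close> be
  represented by exactly one HOL function.\<close>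

definition unit_functions :: "'a topology \<Rightarrow> ('a \<Rightarrow> real) set" where
  "unit_functions X = {f \<in> extensional (topspace X). continuous_map X (top_of_set {0..1}) f}"

definition beta_cube :: "'a topology \<Rightarrow> (('a \<Rightarrow> real) \<Rightarrow> real) topology" where
  "beta_cube X = product_topology (\<lambda>_. top_of_set {0..1}) (unit_functions X)"

definition beta_eval :: "'a topology \<Rightarrow> 'a \<Rightarrow> ('a \<Rightarrow> real) \<Rightarrow> real" where
  "beta_eval X x = (\<lambda>f \<in> unit_functions X. f x)"

definition cech_stone :: "'a topology \<Rightarrow> (('a \<Rightarrow> real) \<Rightarrow> real) topology" where
  "cech_stone X =
     subtopology (beta_cube X) (beta_cube X closure_of (beta_eval X ` topspace X))"

lemma beta_eval_image: "beta_eval X ` topspace X \<subseteq> topspace (beta_cube X)"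
  by (force simp: beta_eval_def beta_cube_def unit_functions_def continuous_map_in_subtopology
      PiE_iff Pi_iff)

lemma compact_space_cech_stone: "compact_space (cech_stone X)"
proof -
  have "compact_space (beta_cube X)"
    by (auto simp: beta_cube_def compact_space_product_topology compact_space_subtopology)
  then show ?thesis
    by (simp add: cech_stone_def closedin_compact_space compact_space_subtopology)
qed

lemma Hausdorff_space_cech_stone: "Hausdorff_space (cech_stone X)"
  by (simp add: cech_stone_def beta_cube_def Hausdorff_space_subtopology
      Hausdorff_space_product_topology)

lemma beta_eval_dense:
  "cech_stone X closure_of (beta_eval X ` topspace X) = topspace (cech_stone X)"
proof -
  let ?S = "beta_eval X ` topspace X"
  have "?S \<subseteq> beta_cube X closure_of ?S"
    by (simp add: beta_eval_image closure_of_subset)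
  then show ?thesis
    by (simp add: cech_stone_def closure_of_subtopology closure_of_subset_topspace Int_absorb1 Int_absorb2)
qed

lemma embedding_map_beta_eval:
  assumes "tychonoff_space X"
  shows "embedding_map X (cech_stone X) (beta_eval X)"
proof -
  let ?S = "beta_eval X ` topspace X"
  have X: "completely_regular_space X" "Hausdorff_space X"
    using assms completely_regular_imp_regular_space regular_t1_eq_Hausdorff_space
    by (auto simp: tychonoff_space_def)
  have K: "mspace (submetric (cfunspace X euclidean_metric) {f. f \<in> topspace X \<rightarrow> {0..1}})
      = unit_functions X"
  proof -
    have "bounded (f ` topspace X)" if "f \<in> topspace X \<rightarrow> {0..1}" for f :: "'a \<Rightarrow> real"
      by (rule bounded_subset [of "{0..1}"]) (use that in auto)
    then show ?thesis
      by (auto simp: unit_functions_def continuous_map_in_subtopology)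
  qed
  have "embedding_map X (beta_cube X) (beta_eval X)"
    using completely_regular_space_cube_embedding_explicit [OF X]
    unfolding K beta_cube_def beta_eval_def by simp
  moreover have "?S \<subseteq> beta_cube X closure_of ?S"
    by (simp add: beta_eval_image closure_of_subset)
  ultimately show ?thesis
    by (simp add: cech_stone_def embedding_map_in_subtopology)
qed

lemma cech_stone_extension:
  assumes "continuous_map X (top_of_set {0..1}) f"
  obtains g where "continuous_map (cech_stone X) (top_of_set {0..1::real}) g"
    and "\<And>x. x \<in> topspace X \<Longrightarrow> g (beta_eval X x) = f x"
proof
  let ?f = "restrict f (topspace X)"
  have f: "?f \<in> unit_functions X"
    using assms by (auto simp: unit_functions_def intro: continuous_map_eq)
  show "continuous_map (cech_stone X) (top_of_set {0..1}) (\<lambda>z. z ?f)"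
    unfolding cech_stone_def beta_cube_def
    by (intro continuous_map_from_subtopology continuous_map_product_projection f)
  show "beta_eval X x ?f = f x" if "x \<in> topspace X" for x
    using f that by (simp add: beta_eval_def)
qed

text \<open>HOL cannot quantify existentially over types, so the underlying set of a space is taken to be
  a subset (the \<open>topspace\<close>) of one fixed type, of cardinality \<open>\<beth>\<^sub>5\<close>; this leaves
  room for a homeomorphic copy of every space with at most that many points.\<close>

type_synonym large_type = "nat set set set set set"

end

theory Submission
  imports Defs
begin

text \<open>The corona is the compact zero-dimensional \<open>F\<close>-space of all ultrafilters on \<open>\<nat> \<times> \<nat>\<close> along which
  the first coordinate tends to infinity. The maps \<open>(n, i) \<mapsto> (n, \<lfloor>i/2\<rfloor>)\<close> and
  \<open>(n, i) \<mapsto> (n, \<lceil>i/2\<rceil>)\<close> identify \<open>2j\<close> with \<open>2j + 1\<close>, respectively \<open>2j + 1\<close> with \<open>2j + 2\<close>.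
  A function on the corona that factors through both is induced by some \<open>g\<close> with
  \<open>g (n, i) - g (n, i + 1) \<rightarrow> 0\<close> uniformly in \<open>i\<close>; it may be real-valued and nonconstant on the levels,
  but if it is two-valued then \<open>g\<close> is nearly constant on almost every level.

  Such a function is forced by a Tychonoff plank without its corner: over each pair \<open>(a, b)\<close> there is
  a copy of the corona, all but countably many copies in a column converge to the quotient by the first
  map, and all but at most continuum many copies in a row converge to the quotient by the second. By
  compactness a continuous function is equal, on all but few copies, to the pullback of its limit, so
  by counting some copy carries a function that factors through both quotients. Hence no clopen set
  separates the two ends of the levels, although a real function does. The plank is zero-dimensional
  since each of its points has a clopen neighbourhood inside one row or one column.\<close>

unbundle cardinal_syntax

unbundle cardinal_syntax

section \<open>Ultrafilters\<close>

text \<open>Ultrafilters are values of the filter type, so \<open>filtermap\<close>,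
  \<open>tendsto\<close> and \<open>Lim\<close> apply to them directly; properness has to be stated
  because \<open>bot\<close> is also a filter.\<close>

definition ultra :: "'a filter \<Rightarrow> bool" where
  "ultra p \<longleftrightarrow> p \<noteq> bot \<and> (\<forall>P. eventually P p \<or> eventually (\<lambda>x. \<not> P x) p)"

lemma ultra_not:
  assumes "ultra p"
  shows "eventually (\<lambda>x. \<not> P x) p \<longleftrightarrow> \<not> eventually P p"
proof
  assume *: "eventually (\<lambda>x. \<not> P x) p"
  show "\<not> eventually P p"
  proof
    assume "eventually P p"
    with * have "eventually (\<lambda>x. False) p"
      by eventually_elim auto
    then show False
      using assms by (simp add: ultra_def trivial_limit_def)
  qed
qed (use assms in \<open>auto simp: ultra_def\<close>)

lemma ultra_filtermap: "ultra p \<Longrightarrow> ultra (filtermap f p)"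
  by (simp add: ultra_def eventually_filtermap filtermap_bot_iff)

lemma ultra_le_eq:
  assumes "ultra p" "ultra q" "p \<le> q"
  shows "p = q"
proof (rule antisym [OF assms(3)], rule filter_leI)
  fix P assume "eventually P p"
  then show "eventually P q"
    using assms ultra_not [of p P] ultra_not [of q P] by (meson filter_leD)
qed

lemma ultra_ex_finite:
  assumes "ultra p" "finite I" "eventually (\<lambda>x. \<exists>i\<in>I. P i x) p"
  shows "\<exists>i\<in>I. eventually (P i) p"
proof (rule ccontr)
  assume "\<not> ?thesis"
  then have "\<forall>i\<in>I. eventually (\<lambda>x. \<not> P i x) p"
    using assms(1) by (simp add: ultra_not)
  then have "eventually (\<lambda>x. \<forall>i\<in>I. \<not> P i x) p"
    by (simp add: eventually_ball_finite_distrib assms(2))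
  then have "eventually (\<lambda>x. \<not> (\<exists>i\<in>I. P i x)) p"
    by simp
  with assms(1,3) show False
    using ultra_not by blast
qed

text \<open>Zorn's lemma for the reversed order: a minimal proper filter below \<open>F\<close> is
  an ultrafilter.\<close>

lemma ultra_exists:
  fixes F :: "'a filter"
  assumes "F \<noteq> bot"
  obtains p where "ultra p" "p \<le> F"
proof -
  define \<A> where "\<A> = {p. p \<noteq> bot \<and> p \<le> F}"
  have "\<exists>m\<in>\<A>. \<forall>a\<in>\<A>. m \<ge> a \<longrightarrow> a = m"
  proof (rule predicate_Zorn)
    show "partial_order_on \<A> (relation_of (\<ge>) \<A>)"
      by (auto simp: partial_order_on_def preorder_on_def refl_on_def trans_def antisym_def relation_of_def)
    fix C assume C: "C \<in> Chains (relation_of (\<ge>) \<A>)"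
    then have C\<A>: "C \<subseteq> \<A>" and tot: "\<And>F G. F \<in> C \<Longrightarrow> G \<in> C \<Longrightarrow> F \<le> G \<or> G \<le> F"
      by (auto simp: Chains_def relation_of_def)
    show "\<exists>u\<in>\<A>. \<forall>a\<in>C. u \<le> a"
    proof (cases "C = {}")
      case True
      then show ?thesis using assms by (auto simp: \<A>_def)
    next
      case False
      \<comment> \<open>A chain is directed downwards, so an event of the infimum is already an
        event of some member; hence the infimum stays proper.\<close>
      have "eventually P (Inf C) \<longleftrightarrow> (\<exists>b\<in>C. eventually P b)" for P
      proof (rule eventually_Inf_base [OF False])
        fix F G assume "F \<in> C" "G \<in> C"
        then show "\<exists>x\<in>C. x \<le> inf F G"
          using tot [of F G] by (metis inf.orderE inf.commute order_refl)
      qed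
      then have "Inf C \<noteq> bot"
        using C\<A> by (auto simp: trivial_limit_def \<A>_def)
      moreover obtain a where "a \<in> C" "a \<le> F"
        using False C\<A> by (auto simp: \<A>_def)
      then have "Inf C \<le> F"
        by (rule Inf_lower2)
      ultimately show ?thesis
        by (auto simp: \<A>_def intro: Inf_lower)
    qed
  qed
  then obtain p where p: "p \<in> \<A>" and max: "\<And>a. a \<in> \<A> \<Longrightarrow> a \<le> p \<Longrightarrow> a = p"
    by blast
  \<comment> \<open>If \<open>P\<close> is not an event of \<open>p\<close>, adding its complement
    gives a proper filter below \<open>p\<close>, which by minimality is \<open>p\<close>
    itself.\<close>
  have "eventually (\<lambda>x. \<not> P x) p" if "\<not> eventually P p" for P
  proof -
    let ?q = "inf p (principal {x. \<not> P x})"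
    have "?q \<noteq> bot"
      using that by (simp add: trivial_limit_def eventually_inf_principal)
    then have "?q = p"
      using p by (intro max) (auto simp: \<A>_def le_infI1)
    then have "p \<le> principal {x. \<not> P x}"
      by (metis inf_le2)
    then show ?thesis
      by (simp add: le_principal)
  qed
  then show ?thesis
    using p that [of p] by (auto simp: ultra_def \<A>_def)
qed

lemma eventually_if_ultra:
  assumes "\<And>p. ultra p \<Longrightarrow> p \<le> F \<Longrightarrow> eventually P p"
  shows "eventually P F"
proof (rule ccontr)
  assume "\<not> eventually P F"
  then have "inf F (principal {x. \<not> P x}) \<noteq> bot"
    by (simp add: trivial_limit_def eventually_inf_principal)
  then obtain p where p: "ultra p" "p \<le> inf F (principal {x. \<not> P x})"
    by (rule ultra_exists)
  then have "eventually P p" "eventually (\<lambda>x. \<not> P x) p"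
    using assms by (auto simp: le_principal)
  with p show False
    by (simp add: ultra_not)
qed

text \<open>Compactness of the set of ultrafilters below \<open>F\<close>: if no finitely many
  \<open>E p\<close> covered, the complements would have the finite intersection property over
  \<open>F\<close>, and an ultrafilter \<open>q\<close> containing them all would miss its own
  \<open>E q\<close>.\<close>

lemma ultra_compact:
  assumes "\<And>p. ultra p \<Longrightarrow> p \<le> F \<Longrightarrow> eventually (E p) p"
  shows "\<exists>P. finite P \<and> (\<forall>p\<in>P. ultra p \<and> p \<le> F) \<and> eventually (\<lambda>x. \<exists>p\<in>P. E p x) F"
proof (rule ccontr)
  assume "\<not> ?thesis"
  then have *: "\<not> eventually (\<lambda>x. \<exists>p\<in>P. E p x) F"
    if "finite P" "\<And>p. p \<in> P \<Longrightarrow> ultra p \<and> p \<le> F" for P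
    using that by blast
  let ?S = "{p. ultra p \<and> p \<le> F}"
  let ?G = "\<lambda>p. inf F (principal {x. \<not> E p x})"
  have G: "(INF p\<in>?S. ?G p) \<noteq> bot"
  proof (rule INF_filter_not_bot)
    fix X assume X: "X \<subseteq> ?S" "finite X"
    have "inf F (principal {x. \<forall>p\<in>X. \<not> E p x}) \<noteq> bot"
      using * [of X] X by (auto simp: trivial_limit_def eventually_inf_principal)
    moreover have "inf F (principal {x. \<forall>p\<in>X. \<not> E p x}) \<le> (INF p\<in>X. ?G p)"
      by (rule INF_greatest) (intro inf_mono order_refl, auto)
    ultimately show "(INF p\<in>X. ?G p) \<noteq> bot"
      by (metis (no_types) bot.extremum_uniqueI)
  qed
  obtain q where q: "ultra q" "q \<le> (INF p\<in>?S. ?G p)"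
    using ultra_exists [OF G] by blast
  \<comment> \<open>Some ultrafilter below \<open>F\<close> is needed to see that the infimum lies
    below \<open>F\<close>, since an infimum over no filters would be \<open>top\<close>.\<close>
  have "F \<noteq> bot"
    using * [of "{}"] by auto
  then obtain p where "ultra p" "p \<le> F"
    by (rule ultra_exists)
  then have "(INF p\<in>?S. ?G p) \<le> ?G p"
    by (intro INF_lower) simp
  with q(2) have "q \<le> F"
    by (meson le_inf_iff order_trans)
  with q(1) have "(INF p\<in>?S. ?G p) \<le> ?G q"
    by (intro INF_lower) simp
  with q(2) have "q \<le> ?G q"
    by (rule order_trans)
  then have "eventually (\<lambda>x. \<not> E q x) q"
    by (simp add: le_principal)
  with assms [OF \<open>ultra q\<close> \<open>q \<le> F\<close>] \<open>ultra q\<close> show False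
    by (simp add: ultra_not)
qed

text \<open>The image filter lives on a compact interval and so has a cluster point; an ultrafilter
  converges to each of its cluster points.\<close>

lemma ultra_bounded_tendsto:
  fixes g :: "'a \<Rightarrow> real"
  assumes p: "ultra p" and g: "\<And>x. \<bar>g x\<bar> \<le> B"
  obtains l where "(g \<longlongrightarrow> l) p"
proof -
  let ?q = "filtermap g p"
  have "?q \<noteq> bot" "eventually (\<lambda>x. x \<in> cball 0 B) ?q"
    using p g by (auto simp: ultra_def filtermap_bot_iff eventually_filtermap)
  then have "\<exists>l. inf (nhds l) ?q \<noteq> bot"
    using compact_cball [of "0::real" B] unfolding compact_filter by blast
  then obtain l where l: "inf (nhds l) ?q \<noteq> bot"
    by blast
  have "?q \<le> nhds l"
  proof (rule filter_leI, rule ccontr)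
    fix P assume P: "eventually P (nhds l)" "\<not> eventually P ?q"
    then have "eventually (\<lambda>x. \<not> P x) ?q"
      using p ultra_filtermap ultra_not by blast
    with P have "eventually (\<lambda>x. False) (inf (nhds l) ?q)"
      unfolding eventually_inf by blast
    then show False
      using l by (simp add: trivial_limit_def)
  qed
  then show ?thesis
    using that by (simp add: filterlim_def)
qed

section \<open>Filters of sets with small complement\<close>

text \<open>The set \<open>R\<close> only supplies a cardinal bound for the complements. Its
  infinitude, assumed in the lemmas, makes unions of two small sets small.\<close>

definition cosmall :: "'b set \<Rightarrow> 'a filter" where
  "cosmall R = Abs_filter (\<lambda>P. |{x. \<not> P x}| \<le>o |R| )"

lemma eventually_cosmall:
  fixes P :: "'a \<Rightarrow> bool"
  assumes "infinite R"
  shows "eventually P (cosmall R) \<longleftrightarrow> |{x. \<not> P x}| \<le>o |R|"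
  unfolding cosmall_def
proof (rule eventually_Abs_filter, unfold_locales)
  show "|{x. \<not> True}| \<le>o |R|"
    by (simp add: card_of_empty)
next
  fix P Q :: "'a \<Rightarrow> bool"
  assume "|{x. \<not> P x}| \<le>o |R|" "|{x. \<not> Q x}| \<le>o |R|"
  then have "|{x. \<not> P x} \<union> {x. \<not> Q x}| \<le>o |R|"
    using assms by (intro card_of_Un_ordLeq_infinite_Field card_of_Card_order) (simp_all only: Field_card_of not_False_eq_True)
  moreover have "{x. \<not> (P x \<and> Q x)} = {x. \<not> P x} \<union> {x. \<not> Q x}"
    by blast
  ultimately show "|{x. \<not> (P x \<and> Q x)}| \<le>o |R|"
    by simp
next
  fix P Q :: "'a \<Rightarrow> bool"
  assume "\<forall>x. P x \<longrightarrow> Q x" and P: "|{x. \<not> P x}| \<le>o |R|"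
  then have "|{x. \<not> Q x}| \<le>o |{x. \<not> P x}|"
    by (intro card_of_mono1) auto
  then show "|{x. \<not> Q x}| \<le>o |R|"
    using P by (rule ordLeq_transitive)
qed

text \<open>A union of at most \<open>|R|\<close> sets of size at most \<open>|R|\<close> has size
  at most \<open>|R|\<close>, when \<open>R\<close> is infinite.\<close>

lemma eventually_cosmall_all:
  assumes "infinite R" "|UNIV :: 'i set| \<le>o |R|" "\<And>i::'i. eventually (P i) (cosmall R)"
  shows "eventually (\<lambda>x. \<forall>i. P i x) (cosmall R)"
proof -
  have "|\<Union>i. {x. \<not> P i x}| \<le>o |R|"
    using assms by (intro card_of_UNION_ordLeq_infinite) (auto simp: eventually_cosmall)
  then show ?thesis
    by (simp add: eventually_cosmall assms(1) Collect_ex_eq)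
qed

lemma eventually_cosmall_neq:
  assumes "infinite R"
  shows "eventually (\<lambda>x. x \<noteq> a) (cosmall R)"
proof -
  have "|{a}| \<le>o |R|"
    using assms by (metis card_of_singl_ordLeq finite.emptyI)
  then show ?thesis
    by (simp add: eventually_cosmall assms)
qed

text \<open>Cantor's theorem: the power set is larger than the bound. Hence a property of most rows
  or most columns holds for at least one.\<close>

lemma cosmall_neq_bot:
  assumes "infinite (UNIV :: 'b set)"
  shows "(cosmall (UNIV :: 'b set) :: 'b set filter) \<noteq> bot"
  using not_ordLess_ordLeq [OF card_of_Pow [of "UNIV :: 'b set"]]
  by (simp add: trivial_limit_def eventually_cosmall assms)

section \<open>The corona\<close>

definition levels :: "(nat \<times> nat) filter" where
  "levels = filtercomap fst at_top"

definition corona :: "(nat \<times> nat) filter set" where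
  "corona = {p. ultra p \<and> p \<le> levels}"

text \<open>Continuity for the Stone topology, whose basic open sets consist of the ultrafilters
  containing a given \<open>E\<close>; it is phrased without building that topology.\<close>

definition corona_continuous :: "((nat \<times> nat) filter \<Rightarrow> real) \<Rightarrow> bool" where
  "corona_continuous \<phi> \<longleftrightarrow> (\<forall>p\<in>corona. \<forall>\<epsilon>>0. \<exists>E. eventually E p \<and>
     (\<forall>q\<in>corona. eventually E q \<longrightarrow> \<bar>\<phi> q - \<phi> p\<bar> < \<epsilon>))"

lemma eventually_levels: "eventually P levels \<longleftrightarrow> (\<exists>N. \<forall>n\<ge>N. \<forall>i. P (n, i))"
  by (auto simp: levels_def eventually_filtercomap_at_top_linorder)

lemma coronaD:
  assumes "p \<in> corona"
  shows "ultra p" "p \<le> levels" "p \<noteq> bot"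
  using assms by (auto simp: corona_def ultra_def)

lemma eventually_levels_corona:
  "eventually P levels \<Longrightarrow> p \<in> corona \<Longrightarrow> eventually P p"
  using coronaD(2) filter_leD by blast

lemma eventually_levels_if_corona:
  "(\<And>p. p \<in> corona \<Longrightarrow> eventually P p) \<Longrightarrow> eventually P levels"
  by (rule eventually_if_ultra) (simp add: corona_def)

lemma tendsto_levels_if_corona:
  "(\<And>p. p \<in> corona \<Longrightarrow> (f \<longlongrightarrow> l) p) \<Longrightarrow> (f \<longlongrightarrow> l) levels"
  by (simp add: tendsto_def eventually_levels_if_corona)

text \<open>A map that preserves levels pulls each tail of levels back to itself, so it acts on the
  corona.\<close>

lemma filtermap_corona:
  assumes p: "p \<in> corona" and s: "\<And>d. fst (s d) = fst d"
  shows "filtermap s p \<in> corona"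
proof -
  have "filtermap s p \<le> levels"
  proof (rule filter_leI)
    fix P assume "eventually P levels"
    then have "eventually (\<lambda>d. P (s d)) levels"
      unfolding eventually_levels using s by (metis fst_conv prod.collapse)
    then show "eventually P (filtermap s p)"
      using p by (simp add: eventually_filtermap eventually_levels_corona)
  qed
  then show ?thesis
    using p by (simp add: corona_def ultra_filtermap)
qed

lemma corona_compact:
  assumes "\<And>p. p \<in> corona \<Longrightarrow> eventually (E p) p"
  shows "\<exists>P. finite P \<and> P \<subseteq> corona \<and> (\<forall>q\<in>corona. \<exists>p\<in>P. eventually (E p) q) \<and>
    eventually (\<lambda>x. \<exists>p\<in>P. E p x) levels"
proof -
  obtain P where P: "finite P" "P \<subseteq> corona" "eventually (\<lambda>x. \<exists>p\<in>P. E p x) levels"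
    using ultra_compact [of levels E] assms by (auto simp: corona_def)
  moreover have "\<exists>p\<in>P. eventually (E p) q" if "q \<in> corona" for q
    using that P by (intro ultra_ex_finite) (auto simp: coronaD eventually_levels_corona)
  ultimately show ?thesis
    by blast
qed

section \<open>Continuous functions on the corona as limits of bounded functions on the grid\<close>

lemma corona_tendsto_Lim:
  fixes u :: "nat \<times> nat \<Rightarrow> real"
  assumes "p \<in> corona" "\<And>d. \<bar>u d\<bar> \<le> B"
  shows "(u \<longlongrightarrow> Lim p u) p"
  using assms by (metis coronaD(1,3) tendsto_Lim ultra_bounded_tendsto)

lemma Lim_filtermap: "Lim (filtermap f p) u = Lim p (\<lambda>x. u (f x))"
  by (simp add: t2_space_class.Lim_def filterlim_filtermap)

lemma Lim_cong_levels:
  fixes u v :: "nat \<times> nat \<Rightarrow> real"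
  assumes p: "p \<in> corona" and u: "\<And>d. \<bar>u d\<bar> \<le> B"
    and uv: "((\<lambda>d. v d - u d) \<longlongrightarrow> 0) levels"
  shows "Lim p v = Lim p u"
proof -
  have "((\<lambda>d. v d - u d) \<longlongrightarrow> 0) p"
    using uv coronaD(2) [OF p] tendsto_mono by blast
  from tendsto_add [OF corona_tendsto_Lim [where u = u, OF p u] this] show ?thesis
    using coronaD(3) [OF p] by (simp add: tendsto_Lim)
qed

lemma corona_continuous_Lim:
  fixes u :: "nat \<times> nat \<Rightarrow> real"
  assumes u: "\<And>d. \<bar>u d\<bar> \<le> B"
  shows "corona_continuous (\<lambda>p. Lim p u)"
  unfolding corona_continuous_def
proof (intro ballI allI impI)
  fix p and \<epsilon> :: real assume p: "p \<in> corona" and "\<epsilon> > 0"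
  \<comment> \<open>Half of \<epsilon>, because passing to the limit along \<open>q\<close> leaves
    only a weak inequality.\<close>
  let ?E = "\<lambda>d. dist (u d) (Lim p u) < \<epsilon>/2"
  have "eventually ?E p"
    using \<open>\<epsilon> > 0\<close> by (intro tendstoD [OF corona_tendsto_Lim [where u = u, OF p u]]) simp
  moreover have "\<bar>Lim q u - Lim p u\<bar> < \<epsilon>" if q: "q \<in> corona" and E: "eventually ?E q" for q
  proof -
    have "((\<lambda>d. dist (u d) (Lim p u)) \<longlongrightarrow> dist (Lim q u) (Lim p u)) q"
      by (intro tendsto_intros corona_tendsto_Lim [where u = u, OF q u])
    then have "dist (Lim q u) (Lim p u) \<le> \<epsilon>/2"
      by (rule tendsto_upperbound) (use E q in \<open>auto simp: coronaD elim: eventually_mono\<close>)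
    then show ?thesis
      using \<open>\<epsilon> > 0\<close> by (simp add: dist_real_def)
  qed
  ultimately show "\<exists>E. eventually E p \<and> (\<forall>q\<in>corona. eventually E q \<longrightarrow> \<bar>Lim q u - Lim p u\<bar> < \<epsilon>)"
    by blast
qed

lemma corona_continuous_cong:
  assumes "\<And>p. p \<in> corona \<Longrightarrow> \<phi> p = \<psi> p"
  shows "corona_continuous \<phi> \<longleftrightarrow> corona_continuous \<psi>"
  using assms by (simp add: corona_continuous_def)

text \<open>Finitely many sets \<open>E p\<close> cover almost all levels; each grid point gets the
  value of \<phi> at a centre \<open>p\<close> whose set contains it. Centres whose set is not in
  \<open>q\<close> are negligible along \<open>q\<close>, and the others have values close to that
  at \<open>q\<close>.\<close>

lemma corona_continuous_simple_approx:
  assumes \<phi>: "corona_continuous \<phi>" and "\<epsilon> > 0"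
  obtains g where "\<And>p. p \<in> corona \<Longrightarrow> eventually (\<lambda>d. \<bar>g d - \<phi> p\<bar> < \<epsilon>) p"
proof -
  have "\<forall>p\<in>corona. \<exists>E. eventually E p \<and> (\<forall>q\<in>corona. eventually E q \<longrightarrow> \<bar>\<phi> q - \<phi> p\<bar> < \<epsilon>)"
    using \<phi> \<open>\<epsilon> > 0\<close> by (simp add: corona_continuous_def)
  from bchoice [OF this] obtain E where E: "\<And>p. p \<in> corona \<Longrightarrow> eventually (E p) p"
    and \<phi>E: "\<And>p q. p \<in> corona \<Longrightarrow> q \<in> corona \<Longrightarrow> eventually (E p) q \<Longrightarrow> \<bar>\<phi> q - \<phi> p\<bar> < \<epsilon>"
    by blast
  obtain P where P: "finite P" "P \<subseteq> corona"
    and cov: "eventually (\<lambda>d. \<exists>p\<in>P. E p d) levels"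
    using corona_compact [of E, OF E] by blast
  define g where "g d = \<phi> (SOME p. p \<in> P \<and> E p d)" for d
  show thesis
  proof (rule that)
    fix q assume q: "q \<in> corona"
    have "\<forall>p\<in>P. eventually (\<lambda>d. E p d \<longrightarrow> \<bar>\<phi> q - \<phi> p\<bar> < \<epsilon>) q"
    proof
      fix p assume "p \<in> P"
      then show "eventually (\<lambda>d. E p d \<longrightarrow> \<bar>\<phi> q - \<phi> p\<bar> < \<epsilon>) q"
      proof (cases "eventually (E p) q")
        case True
        then show ?thesis
          using \<phi>E [of p q] \<open>p \<in> P\<close> P(2) q by auto
      next
        case False
        then have "eventually (\<lambda>d. \<not> E p d) q"
          using ultra_not coronaD(1) q by blast
        then show ?thesis
          by eventually_elim simp
      qed
    qed
    then have "eventually (\<lambda>d. \<forall>p\<in>P. E p d \<longrightarrow> \<bar>\<phi> q - \<phi> p\<bar> < \<epsilon>) q"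
      by (simp add: eventually_ball_finite_distrib P(1))
    with eventually_levels_corona [OF cov q]
    show "eventually (\<lambda>d. \<bar>g d - \<phi> q\<bar> < \<epsilon>) q"
    proof eventually_elim
      case (elim d)
      define p where "p = (SOME p. p \<in> P \<and> E p d)"
      have "p \<in> P \<and> E p d"
        unfolding p_def by (rule someI_ex) (use elim in blast)
      with elim show ?case
        by (auto simp: g_def abs_minus_commute simp flip: p_def)
    qed
  qed
qed

text \<open>A converse of \<open>corona_continuous_Lim\<close>: finite-valued approximations with
  errors tending to 0 are merged into one function, which is possible because only the tail of the
  levels matters.\<close>

lemma corona_continuous_represent:
  assumes \<phi>: "corona_continuous \<phi>" and bd: "\<And>p. p \<in> corona \<Longrightarrow> \<bar>\<phi> p\<bar> \<le> 1"
  obtains g where "\<And>d. \<bar>g d\<bar> \<le> (1::real)" "\<And>p. p \<in> corona \<Longrightarrow> (g \<longlongrightarrow> \<phi> p) p"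
proof -
  have "\<exists>G. \<forall>p\<in>corona. eventually (\<lambda>d. \<bar>G d - \<phi> p\<bar> < 1 / real (Suc m)) p" for m
    by (rule corona_continuous_simple_approx [OF \<phi>, of "1 / real (Suc m)"]) auto
  then obtain G where G: "\<And>m p. p \<in> corona \<Longrightarrow> eventually (\<lambda>d. \<bar>G m d - \<phi> p\<bar> < 1 / real (Suc m)) p"
    by metis
  \<comment> \<open>Approximations with errors \<open>1/(j+1)\<close> and \<open>1/(m+1)\<close>,
    where \<open>j \<le> m\<close>, differ by at most \<open>2/(j+1)\<close> on all late levels. The
    bound \<open>m \<le> n\<close> makes a greatest \<open>m\<close> exist, and \<open>m = 0\<close>
    always qualifies.\<close>
  define ok where "ok n m \<longleftrightarrow> m \<le> n \<and>
    (\<forall>j\<le>m. \<forall>i. \<bar>G j (n,i) - G m (n,i)\<bar> \<le> 2 / real (Suc j))" for n m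
  \<comment> \<open>Diagonalisation: on level \<open>n\<close> use the best approximation that is already trustworthy there.\<close>
  define M where "M n = (GREATEST m. ok n m)" for n
  have ok: "ok n (M n)" for n
    unfolding M_def by (rule GreatestI_nat [of _ 0 n]) (auto simp: ok_def)
  have M: "eventually (\<lambda>n. j \<le> M n) at_top" for j
  proof -
    have "eventually (\<lambda>d. \<forall>k\<le>j. \<bar>G k d - G j d\<bar> \<le> 2 / real (Suc k)) levels"
    proof (rule eventually_levels_if_corona)
      fix p assume p: "p \<in> corona"
      have "eventually (\<lambda>d. \<bar>G k d - G j d\<bar> \<le> 2 / real (Suc k)) p" if "k \<le> j" for k
        using G [OF p, of k] G [OF p, of j]
      proof eventually_elim
        case (elim d)
        have "1 / real (Suc j) \<le> 1 / real (Suc k)"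
          using that by (simp add: frac_le)
        with elim show ?case
          by (simp add: abs_less_iff abs_le_iff)
      qed
      then show "eventually (\<lambda>d. \<forall>k\<le>j. \<bar>G k d - G j d\<bar> \<le> 2 / real (Suc k)) p"
        using eventually_ball_finite [of "{..j}" "\<lambda>d k. \<bar>G k d - G j d\<bar> \<le> 2 / real (Suc k)"]
        by (simp add: Ball_def)
    qed
    then obtain N where "\<forall>n\<ge>N. \<forall>i. \<forall>k\<le>j. \<bar>G k (n,i) - G j (n,i)\<bar> \<le> 2 / real (Suc k)"
      by (auto simp: eventually_levels)
    then have "ok n j" if "n \<ge> max N j" for n
      using that by (auto simp: ok_def)
    then have "j \<le> M n" if "n \<ge> max N j" for n
      unfolding M_def using that by (intro Greatest_le_nat [of _ j n]) (auto simp: ok_def)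
    then show ?thesis
      using eventually_at_top_linorder by blast
  qed
  \<comment> \<open>Truncation keeps the limits, since \<phi> itself takes values in
    \<open>[-1,1]\<close>.\<close>
  define g where "g d = max (-1) (min 1 (G (M (fst d)) d))" for d
  have "(g \<longlongrightarrow> \<phi> p) p" if p: "p \<in> corona" for p
  proof (rule tendstoI)
    fix \<epsilon> :: real assume "\<epsilon> > 0"
    \<comment> \<open>Two of the three parts bound the distance from \<open>G j\<close> to the
      diagonal choice, by \<open>ok\<close>; the third is the error of \<open>G j\<close>.\<close>
    then obtain j where j: "3 / real (Suc j) < \<epsilon>"
      using reals_Archimedean [of "\<epsilon>/3"] by (auto simp: field_simps)
    have "eventually (\<lambda>d. j \<le> M (fst d)) levels"
      unfolding levels_def using M by (rule eventually_filtercomapI)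
    from eventually_levels_corona [OF this p] G [OF p, of j]
    show "eventually (\<lambda>d. dist (g d) (\<phi> p) < \<epsilon>) p"
    proof eventually_elim
      case (elim d)
      have "\<bar>G j d - G (M (fst d)) d\<bar> \<le> 2 / real (Suc j)"
        using ok [of "fst d"] elim by (cases d) (auto simp: ok_def)
      then have "\<bar>G (M (fst d)) d - \<phi> p\<bar> < 3 / real (Suc j)"
        using elim by (simp add: field_simps abs_less_iff abs_le_iff)
      then show ?case
        using bd [OF p] j unfolding g_def dist_real_def by linarith
    qed
  qed
  moreover have "\<bar>g d\<bar> \<le> 1" for d
    by (simp add: g_def)
  ultimately show thesis
    using that by blast
qed

text \<open>Compactness makes the exceptional sets uniform in the point of the corona, and countable
  completeness of \<open>F\<close> turns approximate equality into equality.\<close>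

lemma corona_uniformization:
  fixes F :: "'i filter"
  assumes s: "\<And>d. fst (s d) = fst d"
    and \<sigma>: "\<And>P :: nat \<Rightarrow> 'i \<Rightarrow> bool. (\<And>n. eventually (P n) F) \<Longrightarrow> eventually (\<lambda>x. \<forall>n. P n x) F"
    and near: "\<And>p \<epsilon>. p \<in> corona \<Longrightarrow> \<epsilon> > 0 \<Longrightarrow> \<exists>E. eventually E p \<and>
      (\<forall>q\<in>corona. eventually E q \<longrightarrow> \<bar>\<phi> q - \<phi> p\<bar> < \<epsilon>) \<and>
      (\<forall>\<^sub>F a in F. \<forall>q\<in>corona. eventually (\<lambda>d. E (s d)) q \<longrightarrow> \<bar>\<psi> a q - \<phi> p\<bar> < \<epsilon>)"
  shows "\<forall>\<^sub>F a in F. \<forall>q\<in>corona. \<psi> a q = (\<phi> (filtermap s q) :: real)"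
proof -
  have *: "\<forall>\<^sub>F a in F. \<forall>q\<in>corona. \<bar>\<psi> a q - \<phi> (filtermap s q)\<bar> < 2 * \<epsilon>" if "\<epsilon> > 0" for \<epsilon>
  proof -
    have "\<forall>p\<in>corona. \<exists>E. eventually E p \<and>
        (\<forall>q\<in>corona. eventually E q \<longrightarrow> \<bar>\<phi> q - \<phi> p\<bar> < \<epsilon>) \<and>
        (\<forall>\<^sub>F a in F. \<forall>q\<in>corona. eventually (\<lambda>d. E (s d)) q \<longrightarrow> \<bar>\<psi> a q - \<phi> p\<bar> < \<epsilon>)"
      using near that by blast
    from bchoice [OF this] obtain E where E: "\<And>p. p \<in> corona \<Longrightarrow> eventually (E p) p"
      and \<phi>E: "\<And>p q. p \<in> corona \<Longrightarrow> q \<in> corona \<Longrightarrow> eventually (E p) q \<Longrightarrow> \<bar>\<phi> q - \<phi> p\<bar> < \<epsilon>"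
      and \<psi>E: "\<And>p. p \<in> corona \<Longrightarrow> \<forall>\<^sub>F a in F. \<forall>q\<in>corona.
        eventually (\<lambda>d. E p (s d)) q \<longrightarrow> \<bar>\<psi> a q - \<phi> p\<bar> < \<epsilon>"
      by blast
    obtain P where P: "finite P" "P \<subseteq> corona"
      and cov: "\<And>q. q \<in> corona \<Longrightarrow> \<exists>p\<in>P. eventually (E p) q"
      using corona_compact [of E, OF E] by blast
    have "\<forall>\<^sub>F a in F. \<forall>p\<in>P. \<forall>q\<in>corona.
        eventually (\<lambda>d. E p (s d)) q \<longrightarrow> \<bar>\<psi> a q - \<phi> p\<bar> < \<epsilon>"
      using P \<psi>E by (auto simp: eventually_ball_finite_distrib)
    then show ?thesis
    proof eventually_elim
      case (elim a)
      show ?case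
      proof
        fix q assume q: "q \<in> corona"
        then have sq: "filtermap s q \<in> corona"
          using s by (rule filtermap_corona)
        then obtain p where p: "p \<in> P" "eventually (E p) (filtermap s q)"
          using cov by blast
        then have "\<bar>\<psi> a q - \<phi> p\<bar> < \<epsilon>" "\<bar>\<phi> (filtermap s q) - \<phi> p\<bar> < \<epsilon>"
          using elim q sq P(2) \<phi>E by (auto simp: eventually_filtermap)
        then show "\<bar>\<psi> a q - \<phi> (filtermap s q)\<bar> < 2 * \<epsilon>"
          by linarith
      qed
    qed
  qed
  have "\<forall>\<^sub>F a in F. \<forall>n. \<forall>q\<in>corona. \<bar>\<psi> a q - \<phi> (filtermap s q)\<bar> < 2 * (1 / real (Suc n))"
    by (intro \<sigma> *) simp
  then show ?thesis
  proof eventually_elim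
    case (elim a)
    show ?case
    proof (rule ballI, rule ccontr)
      fix q assume "q \<in> corona" and "\<psi> a q \<noteq> \<phi> (filtermap s q)"
      then obtain n where n: "1 / real (Suc n) < \<bar>\<psi> a q - \<phi> (filtermap s q)\<bar> / 2"
        using reals_Archimedean [of "\<bar>\<psi> a q - \<phi> (filtermap s q)\<bar> / 2"]
        by (auto simp: inverse_eq_divide)
      have "\<bar>\<psi> a q - \<phi> (filtermap s q)\<bar> < 2 * (1 / real (Suc n))"
        using elim \<open>q \<in> corona\<close> by blast
      with n show False
        by (smt (verit) field_sum_of_halves)
    qed
  qed
qed

section \<open>Sign functions on the corona\<close>

text \<open>Supplies a denominator \<open>s\<close> that tends to 0 so slowly that
  \<open>u / s\<close> still tends to 0, being bounded by \<open>s\<close>.\<close>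

lemma levels_dominating_square:
  fixes u :: "nat \<times> nat \<Rightarrow> real"
  assumes u: "(u \<longlongrightarrow> 0) levels"
  obtains s :: "nat \<Rightarrow> real" where "\<And>n. s n > 0" "s \<longlonglongrightarrow> 0"
    "eventually (\<lambda>d. \<bar>u d\<bar> \<le> (s (fst d))\<^sup>2) levels"
proof -
  \<comment> \<open>The cut at 1 keeps the supremum finite on the early levels; on late levels
    \<open>\<bar>u d\<bar> < 1\<close> and the cut changes nothing.\<close>
  define \<delta> where "\<delta> n = (SUP i. min 1 \<bar>u (n, i)\<bar>)" for n
  have bdd: "bdd_above (range (\<lambda>i. min 1 \<bar>u (n, i)\<bar>))" for n
    by (rule bdd_aboveI [of _ 1]) auto
  have le: "min 1 \<bar>u (n, i)\<bar> \<le> \<delta> n" for n i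
    unfolding \<delta>_def by (rule cSUP_upper [OF _ bdd]) auto
  have pos: "\<delta> n \<ge> 0" for n
    using le [of n 0] by (smt (verit))
  have "\<delta> \<longlonglongrightarrow> 0"
  proof (rule tendstoI)
    fix \<epsilon> :: real assume "\<epsilon> > 0"
    then have "eventually (\<lambda>d. \<bar>u d\<bar> < \<epsilon>/2) levels"
      using tendstoD [OF u, of "\<epsilon>/2"] by simp
    then obtain N where N: "\<And>n i. n \<ge> N \<Longrightarrow> \<bar>u (n, i)\<bar> < \<epsilon>/2"
      by (auto simp: eventually_levels)
    have "\<delta> n \<le> \<epsilon>/2" if "n \<ge> N" for n
    proof -
      have "min 1 \<bar>u (n, i)\<bar> \<le> \<epsilon>/2" for i
        using N [OF that, of i] by linarith
      then show ?thesis
        unfolding \<delta>_def by (intro cSUP_least) auto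
    qed
    then have "dist (\<delta> n) 0 < \<epsilon>" if "n \<ge> N" for n
      using that pos [of n] \<open>\<epsilon> > 0\<close> by (smt (verit) dist_real_def field_sum_of_halves)
    then show "eventually (\<lambda>n. dist (\<delta> n) 0 < \<epsilon>) at_top"
      using eventually_at_top_linorder by blast
  qed
  \<comment> \<open>The added \<open>1/(n+1)\<close> keeps \<open>s\<close> positive where \<delta>
    vanishes.\<close>
  define s where "s n = sqrt (\<delta> n) + 1 / real (Suc n)" for n
  show thesis
  proof (rule that)
    show "s n > 0" for n
      by (simp add: s_def add_nonneg_pos pos)
    have "(\<lambda>n. sqrt (\<delta> n) + 1 / real (Suc n)) \<longlonglongrightarrow> sqrt 0 + 0"
      by (intro tendsto_intros \<open>\<delta> \<longlonglongrightarrow> 0\<close> LIMSEQ_Suc [OF lim_1_over_n])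
    then show "s \<longlonglongrightarrow> 0"
      by (simp add: s_def [abs_def])
    have "eventually (\<lambda>d. \<bar>u d\<bar> < 1) levels"
      using tendstoD [OF u, of 1] by simp
    then show "eventually (\<lambda>d. \<bar>u d\<bar> \<le> (s (fst d))\<^sup>2) levels"
    proof eventually_elim
      case (elim d)
      have "\<bar>u d\<bar> \<le> \<delta> (fst d)"
        using le [of "fst d" "snd d"] elim by simp
      also have "\<dots> = (sqrt (\<delta> (fst d)))\<^sup>2"
        using pos by simp
      also have "\<dots> \<le> (s (fst d))\<^sup>2"
        by (intro power_mono) (auto simp: s_def pos)
      finally show ?case .
    qed
  qed
qed

text \<open>The Lipschitz constant \<open>2/s\<close> is uniform in the arguments, so a change of at
  most the square of \<open>s\<close> in the argument changes the smoothed sign by at most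
  \<open>2 * s\<close>.\<close>

lemma smoothed_sign_Lipschitz:
  fixes x y s :: real
  assumes "s > 0"
  shows "\<bar>x / (\<bar>x\<bar> + s) - y / (\<bar>y\<bar> + s)\<bar> \<le> 2 * \<bar>x - y\<bar> / s"
proof -
  have pos: "\<bar>x\<bar> + s > 0" "\<bar>y\<bar> + s > 0"
    using assms by auto
  have "x / (\<bar>x\<bar> + s) - y / (\<bar>y\<bar> + s)
      = (x - y) / (\<bar>x\<bar> + s) + (y / (\<bar>y\<bar> + s)) * ((\<bar>y\<bar> - \<bar>x\<bar>) / (\<bar>x\<bar> + s))"
    using pos by (simp add: divide_simps) (simp add: algebra_simps)
  also have "\<bar>\<dots>\<bar> \<le> \<bar>x - y\<bar> / (\<bar>x\<bar> + s) + (\<bar>y\<bar> / (\<bar>y\<bar> + s)) * (\<bar>\<bar>y\<bar> - \<bar>x\<bar>\<bar> / (\<bar>x\<bar> + s))"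
    using pos by (intro order_trans [OF abs_triangle_ineq]) (simp add: abs_mult)
  also have "\<dots> \<le> \<bar>x - y\<bar> / s + 1 * (\<bar>x - y\<bar> / s)"
    using pos assms by (intro add_mono mult_mono frac_le) auto
  finally show ?thesis
    by simp
qed

text \<open>The \<open>F\<close>-property of the corona in an equivariant form: every map in
  \<open>J\<close> that leaves \<phi> invariant also leaves the sign \<kappa> invariant. This is
  what allows signs on different copies to be glued.\<close>

lemma corona_sign:
  assumes \<phi>: "corona_continuous \<phi>" and bd: "\<And>p. p \<in> corona \<Longrightarrow> \<bar>\<phi> p\<bar> \<le> 1"
    and J: "finite J" "\<And>e d. e \<in> J \<Longrightarrow> fst (e d) = fst d"
  shows "\<exists>\<kappa>. corona_continuous \<kappa> \<and> (\<forall>p\<in>corona. \<phi> p = \<kappa> p * \<bar>\<phi> p\<bar>) \<and>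
    (\<forall>e\<in>J. (\<forall>p\<in>corona. \<phi> (filtermap e p) = \<phi> p) \<longrightarrow> (\<forall>p\<in>corona. \<kappa> (filtermap e p) = \<kappa> p))"
proof -
  obtain g where g1: "\<And>d. \<bar>g d\<bar> \<le> (1::real)" and g: "\<And>p. p \<in> corona \<Longrightarrow> (g \<longlongrightarrow> \<phi> p) p"
    using corona_continuous_represent [OF \<phi> bd] by blast
  \<comment> \<open>Only the maps under which \<phi> is invariant move \<open>g\<close> by a null
    function; as there are finitely many, one \<open>s\<close> dominates all these differences
    through their sum.\<close>
  define J' where "J' = {e\<in>J. \<forall>p\<in>corona. \<phi> (filtermap e p) = \<phi> p}"
  have "((\<lambda>d. g (e d) - g d) \<longlongrightarrow> 0) levels" if "e \<in> J'" for e
  proof (rule tendsto_levels_if_corona)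
    fix p assume p: "p \<in> corona"
    then have "(g \<longlongrightarrow> \<phi> p) (filtermap e p)"
      using g [of "filtermap e p"] that J by (auto simp: J'_def filtermap_corona)
    then show "((\<lambda>d. g (e d) - g d) \<longlongrightarrow> 0) p"
      using tendsto_diff [OF _ g [OF p]] by (fastforce simp: filterlim_filtermap)
  qed
  then have "((\<lambda>d. \<Sum>e\<in>J'. \<bar>g (e d) - g d\<bar>) \<longlongrightarrow> 0) levels"
    by (intro tendsto_null_sum tendsto_rabs_zero)
  then obtain s :: "nat \<Rightarrow> real" where s: "\<And>n. s n > 0" "s \<longlonglongrightarrow> 0"
    and gs: "eventually (\<lambda>d. \<bar>\<Sum>e\<in>J'. \<bar>g (e d) - g d\<bar>\<bar> \<le> (s (fst d))\<^sup>2) levels"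
    using levels_dominating_square by blast
  have sl: "((\<lambda>d. s (fst d)) \<longlongrightarrow> 0) levels"
    unfolding levels_def by (rule filterlim_compose [OF s(2) filterlim_filtercomap])
  \<comment> \<open>\<open>w\<close> tends to the sign of \<open>\<phi>\<close>, and \<open>s\<close> vanishes so slowly that \<open>w\<close> keeps the invariances of \<open>g\<close>.\<close>
  define w where "w d = g d / (\<bar>g d\<bar> + s (fst d))" for d
  have w1: "\<bar>w d\<bar> \<le> 1" for d
    using s(1) [of "fst d"] by (simp add: w_def divide_simps)
  have we: "((\<lambda>d. w (e d) - w d) \<longlongrightarrow> 0) levels" if e: "e \<in> J'" for e
  proof (rule Lim_null_comparison)
    show "((\<lambda>d. 2 * s (fst d)) \<longlongrightarrow> 0) levels"
      using tendsto_mult_left [OF sl, of 2] by simp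
    show "eventually (\<lambda>d. norm (w (e d) - w d) \<le> 2 * s (fst d)) levels"
      using gs
    proof eventually_elim
      case (elim d)
      have "\<bar>g (e d) - g d\<bar> \<le> (\<Sum>e\<in>J'. \<bar>g (e d) - g d\<bar>)"
        using e J by (intro member_le_sum) (auto simp: J'_def)
      with elim have "\<bar>g (e d) - g d\<bar> \<le> (s (fst d))\<^sup>2"
        by linarith
      then have "2 * \<bar>g (e d) - g d\<bar> / s (fst d) \<le> 2 * s (fst d)"
        using s(1) [of "fst d"] by (simp add: divide_simps power2_eq_square)
      moreover have "fst (e d) = fst d"
        using e J by (auto simp: J'_def)
      ultimately show ?case
        using smoothed_sign_Lipschitz [OF s(1), of "g (e d)" "fst d" "g d"] by (simp add: w_def)
    qed
  qed
  define \<kappa> where "\<kappa> p = Lim p w" for p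
  have "\<phi> p = \<kappa> p * \<bar>\<phi> p\<bar>" if p: "p \<in> corona" for p
  proof (cases "\<phi> p = 0")
    case False
    have "((\<lambda>d. s (fst d)) \<longlongrightarrow> 0) p"
      using sl coronaD(2) [OF p] tendsto_mono by blast
    then have "(w \<longlongrightarrow> \<phi> p / (\<bar>\<phi> p\<bar> + 0)) p"
      unfolding w_def [abs_def] by (intro tendsto_intros g p) (use False in auto)
    then have "\<kappa> p = \<phi> p / (\<bar>\<phi> p\<bar> + 0)"
      unfolding \<kappa>_def using coronaD(3) [OF p] by (rule tendsto_Lim [rotated])
    then show ?thesis
      using False by simp
  qed auto
  moreover have "corona_continuous \<kappa>"
    unfolding \<kappa>_def by (rule corona_continuous_Lim [where u = w, OF w1])
  moreover have "\<kappa> (filtermap e p) = \<kappa> p" if "e \<in> J'" "p \<in> corona" for e p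
    unfolding \<kappa>_def Lim_filtermap by (rule Lim_cong_levels [where u = w, OF that(2) w1 we [OF that(1)]])
  ultimately show ?thesis
    unfolding J'_def by blast
qed

section \<open>The space\<close>

definition floor_half :: "nat \<times> nat \<Rightarrow> nat \<times> nat" where
  "floor_half d = (fst d, snd d div 2)"

definition ceiling_half :: "nat \<times> nat \<Rightarrow> nat \<times> nat" where
  "ceiling_half d = (fst d, Suc (snd d) div 2)"

text \<open>A common section of both halving maps: for either of them, called \<open>s\<close>, a
  function factors through \<open>s\<close> exactly if it is invariant under
  \<open>double \<circ> s\<close>.\<close>

definition double :: "nat \<times> nat \<Rightarrow> nat \<times> nat" where
  "double d = (fst d, 2 * snd d)"

lemma fst_half_double [simp]:
  "fst (floor_half d) = fst d" "fst (ceiling_half d) = fst d" "fst (double d) = fst d"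
  by (simp_all add: floor_half_def ceiling_half_def double_def)

lemma half_double [simp]: "floor_half (double d) = d" "ceiling_half (double d) = d"
  by (simp_all add: floor_half_def ceiling_half_def double_def)

text \<open>There are continuum many rows, with countable sets of them negligible, and more than
  continuum many columns, with sets of size at most continuum negligible.\<close>

abbreviation most_rows :: "nat set filter" where
  "most_rows \<equiv> cosmall (UNIV :: nat set)"

abbreviation most_columns :: "nat set set filter" where
  "most_columns \<equiv> cosmall (UNIV :: nat set set)"

lemma infinite_UNIV_nat_set: "infinite (UNIV :: nat set set)"
  by (simp add: Finite_Set.finite_set)

text \<open>The rectangle of all pairs \<open>(a, b)\<close> is bordered by an end column, whose points are \<open>Row a\<close>,
  and an end row, whose points are \<open>Column b\<close>; the corner is missing. Over each of these
  positions sits a copy of the corona.\<close>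

datatype point =
    Point "nat set" "nat set set" (germ: "(nat \<times> nat) filter")
  | Row "nat set" (germ: "(nat \<times> nat) filter")
  | Column "nat set set" (germ: "(nat \<times> nat) filter")

definition plank :: "point set" where
  "plank = {x. germ x \<in> corona}"

text \<open>The copies \<open>v i\<close> of the corona converge along \<open>F\<close> to the copy \<open>w\<close>, where \<open>v i q\<close> is close to
  \<open>w (filtermap s q)\<close>.\<close>

definition fan_nbhd :: "'i filter \<Rightarrow> (nat \<times> nat \<Rightarrow> nat \<times> nat) \<Rightarrow> ((nat \<times> nat) filter \<Rightarrow> 'x) \<Rightarrow>
    ('i \<Rightarrow> (nat \<times> nat) filter \<Rightarrow> 'x) \<Rightarrow> (nat \<times> nat) filter \<Rightarrow> 'x set \<Rightarrow> bool" where
  "fan_nbhd F s w v p U \<longleftrightarrow> (\<exists>E. eventually E p \<and>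
     (\<forall>q\<in>corona. eventually E q \<longrightarrow> w q \<in> U) \<and>
     (\<forall>\<^sub>F i in F. \<forall>q\<in>corona. eventually (\<lambda>d. E (s d)) q \<longrightarrow> v i q \<in> U))"

lemma fan_nbhd_mono:
  assumes "fan_nbhd F s w v p U" "U \<subseteq> V"
  shows "fan_nbhd F s w v p V"
proof -
  obtain E where E: "eventually E p" "\<forall>q\<in>corona. eventually E q \<longrightarrow> w q \<in> U"
    and ev: "\<forall>\<^sub>F i in F. \<forall>q\<in>corona. eventually (\<lambda>d. E (s d)) q \<longrightarrow> v i q \<in> U"
    using assms by (auto simp: fan_nbhd_def)
  have "\<forall>\<^sub>F i in F. \<forall>q\<in>corona. eventually (\<lambda>d. E (s d)) q \<longrightarrow> v i q \<in> V"
    using ev by eventually_elim (use assms in blast)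
  with E assms(2) show ?thesis
    unfolding fan_nbhd_def by blast
qed

lemma fan_nbhd_Int:
  assumes "fan_nbhd F s w v p U" "fan_nbhd F s w v p V"
  shows "fan_nbhd F s w v p (U \<inter> V)"
proof -
  obtain E E' where E: "eventually E p" "\<forall>q\<in>corona. eventually E q \<longrightarrow> w q \<in> U"
      "eventually E' p" "\<forall>q\<in>corona. eventually E' q \<longrightarrow> w q \<in> V"
    and ev: "\<forall>\<^sub>F i in F. \<forall>q\<in>corona. eventually (\<lambda>d. E (s d)) q \<longrightarrow> v i q \<in> U"
      "\<forall>\<^sub>F i in F. \<forall>q\<in>corona. eventually (\<lambda>d. E' (s d)) q \<longrightarrow> v i q \<in> V"
    using assms unfolding fan_nbhd_def by blast
  have "\<forall>\<^sub>F i in F. \<forall>q\<in>corona. eventually (\<lambda>d. E (s d) \<and> E' (s d)) q \<longrightarrow> v i q \<in> U \<inter> V"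
    using ev by eventually_elim (simp add: eventually_conj_iff)
  with E show ?thesis
    unfolding fan_nbhd_def
    by (intro exI [of _ "\<lambda>d. E d \<and> E' d"]) (simp add: eventually_conj_iff)
qed

text \<open>Approximate agreement for every \<epsilon> becomes exact agreement on most copies by
  \<open>corona_uniformization\<close>; conversely, a neighbourhood in the limit copy is pulled back
  along \<open>s\<close>.\<close>

lemma fan_nbhd_continuous_iff:
  fixes F :: "'i filter" and f :: "'x \<Rightarrow> real"
  assumes s: "\<And>d. fst (s d) = fst d"
    and \<sigma>: "\<And>P :: nat \<Rightarrow> 'i \<Rightarrow> bool. (\<And>n. eventually (P n) F) \<Longrightarrow> eventually (\<lambda>x. \<forall>n. P n x) F"
    and X: "\<And>q. q \<in> corona \<Longrightarrow> w q \<in> X" "\<And>i q. q \<in> corona \<Longrightarrow> v i q \<in> X"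
  shows "(\<forall>p\<in>corona. \<forall>\<epsilon>>0. fan_nbhd F s w v p {y \<in> X. \<bar>f y - f (w p)\<bar> < \<epsilon>}) \<longleftrightarrow>
    corona_continuous (\<lambda>p. f (w p)) \<and>
    (\<forall>\<^sub>F i in F. \<forall>q\<in>corona. f (v i q) = f (w (filtermap s q)))"
    (is "?L \<longleftrightarrow> ?C \<and> ?E")
proof safe
  assume ?L
  then have *: "\<exists>E. eventually E p \<and> (\<forall>q\<in>corona. eventually E q \<longrightarrow> \<bar>f (w q) - f (w p)\<bar> < \<epsilon>) \<and>
      (\<forall>\<^sub>F i in F. \<forall>q\<in>corona. eventually (\<lambda>d. E (s d)) q \<longrightarrow> \<bar>f (v i q) - f (w p)\<bar> < \<epsilon>)"
    if "p \<in> corona" "\<epsilon> > 0" for p \<epsilon>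
    using that X by (simp add: fan_nbhd_def cong: conj_cong ball_cong)
  then show ?C
    unfolding corona_continuous_def by blast
  show ?E
    by (rule corona_uniformization [where \<psi> = "\<lambda>i q. f (v i q)" and \<phi> = "\<lambda>p. f (w p)"])
      (simp_all add: s \<sigma> *)
next
  fix p and \<epsilon> :: real assume ?C ?E "p \<in> corona" "\<epsilon> > 0"
  then obtain E where E: "eventually E p" "\<forall>q\<in>corona. eventually E q \<longrightarrow> \<bar>f (w q) - f (w p)\<bar> < \<epsilon>"
    unfolding corona_continuous_def by blast
  have "\<forall>\<^sub>F i in F. \<forall>q\<in>corona. eventually (\<lambda>d. E (s d)) q \<longrightarrow> \<bar>f (v i q) - f (w p)\<bar> < \<epsilon>"
    using \<open>?E\<close> by eventually_elim (use E s filtermap_corona in \<open>auto simp: eventually_filtermap\<close>)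
  with E X show "fan_nbhd F s w v p {y \<in> X. \<bar>f y - f (w p)\<bar> < \<epsilon>}"
    unfolding fan_nbhd_def by (intro exI [of _ E]) (simp cong: conj_cong ball_cong)
qed

lemma ball_plank:
  "(\<forall>x\<in>plank. P x) \<longleftrightarrow> (\<forall>a b. \<forall>p\<in>corona. P (Point a b p)) \<and>
     (\<forall>a. \<forall>p\<in>corona. P (Row a p)) \<and> (\<forall>b. \<forall>p\<in>corona. P (Column b p))"
    (is "_ \<longleftrightarrow> ?P \<and> ?R \<and> ?C")
proof
  assume *: "?P \<and> ?R \<and> ?C"
  show "\<forall>x\<in>plank. P x"
  proof
    fix x assume "x \<in> plank"
    with * show "P x"
      by (cases x) (auto simp: plank_def)
  qed
qed (auto simp: plank_def)

text \<open>Copies over the rectangle are open and carry their Stone topology; only border points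
  have neighbourhoods that reach into other copies.\<close>

fun nbhd :: "point \<Rightarrow> point set \<Rightarrow> bool" where
  "nbhd (Point a b p) U \<longleftrightarrow> (\<exists>E. eventually E p \<and>
     (\<forall>q\<in>corona. eventually E q \<longrightarrow> Point a b q \<in> U))"
| "nbhd (Row a p) U \<longleftrightarrow> fan_nbhd most_columns ceiling_half (Row a) (Point a) p U"
| "nbhd (Column b p) U \<longleftrightarrow> fan_nbhd most_rows floor_half (Column b) (\<lambda>a. Point a b) p U"

definition plank_topology :: "point topology" where
  "plank_topology = topology (\<lambda>U. U \<subseteq> plank \<and> (\<forall>x\<in>U. nbhd x U))"

lemma nbhd_mono: "nbhd x U \<Longrightarrow> U \<subseteq> V \<Longrightarrow> nbhd x V"
  by (cases x) (auto intro: fan_nbhd_mono)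

lemma nbhd_Int:
  assumes "nbhd x U" "nbhd x V"
  shows "nbhd x (U \<inter> V)"
proof (cases x)
  case (Point a b p)
  obtain E E' where "eventually E p" "\<forall>q\<in>corona. eventually E q \<longrightarrow> Point a b q \<in> U"
    "eventually E' p" "\<forall>q\<in>corona. eventually E' q \<longrightarrow> Point a b q \<in> V"
    using assms unfolding Point by auto
  then show ?thesis
    unfolding Point nbhd.simps
    by (intro exI [of _ "\<lambda>d. E d \<and> E' d"]) (simp add: eventually_conj_iff)
qed (use assms in \<open>auto intro: fan_nbhd_Int\<close>)

lemma nbhd_plank: "nbhd x plank"
  by (cases x) (auto simp: plank_def fan_nbhd_def intro!: exI [of _ "\<lambda>_. True"])

lemma openin_plank: "openin plank_topology U \<longleftrightarrow> U \<subseteq> plank \<and> (\<forall>x\<in>U. nbhd x U)"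
proof -
  have "istopology (\<lambda>U. U \<subseteq> plank \<and> (\<forall>x\<in>U. nbhd x U))"
    unfolding istopology_def
    by (blast intro: nbhd_Int nbhd_mono)
  then show ?thesis
    by (simp add: plank_topology_def)
qed

lemma topspace_plank [simp]: "topspace plank_topology = plank"
  using nbhd_plank openin_plank by (metis openin_subset openin_topspace subset_antisym subset_refl)

lemma continuous_map_plank_nbhd:
  "continuous_map plank_topology euclideanreal f \<longleftrightarrow>
     (\<forall>x\<in>plank. \<forall>\<epsilon>>0. nbhd x {y \<in> plank. \<bar>f y - f x\<bar> < \<epsilon>})"
proof safe
  fix x and \<epsilon> :: real
  assume f: "continuous_map plank_topology euclideanreal f" and "x \<in> plank" "\<epsilon> > 0"
  have "openin plank_topology {y \<in> plank. f y \<in> ball (f x) \<epsilon>}"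
    using openin_continuous_map_preimage [OF f, of "ball (f x) \<epsilon>"] by simp
  then have "nbhd x {y \<in> plank. f y \<in> ball (f x) \<epsilon>}"
    using \<open>x \<in> plank\<close> \<open>\<epsilon> > 0\<close> by (simp add: openin_plank)
  then show "nbhd x {y \<in> plank. \<bar>f y - f x\<bar> < \<epsilon>}"
    by (simp add: dist_real_def abs_minus_commute)
next
  assume *: "\<forall>x\<in>plank. \<forall>\<epsilon>>0. nbhd x {y \<in> plank. \<bar>f y - f x\<bar> < \<epsilon>}"
  have "openin plank_topology {x \<in> plank. f x \<in> V}" if "open V" for V
    unfolding openin_plank
  proof safe
    fix x assume x: "x \<in> plank" "f x \<in> V"
    then obtain \<epsilon> where "\<epsilon> > 0" "ball (f x) \<epsilon> \<subseteq> V"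
      using \<open>open V\<close> openE by blast
    then have "{y \<in> plank. \<bar>f y - f x\<bar> < \<epsilon>} \<subseteq> {x \<in> plank. f x \<in> V}"
      by (force simp: dist_real_def abs_minus_commute)
    moreover have "nbhd x {y \<in> plank. \<bar>f y - f x\<bar> < \<epsilon>}"
      using * x \<open>\<epsilon> > 0\<close> by blast
    ultimately show "nbhd x {x \<in> plank. f x \<in> V}"
      by (rule nbhd_mono [rotated])
  qed
  then show "continuous_map plank_topology euclideanreal f"
    by (simp add: continuous_map_def)
qed

lemma corona_continuous_filtermap:
  assumes \<phi>: "corona_continuous \<phi>" and s: "\<And>d. fst (s d) = fst d"
  shows "corona_continuous (\<lambda>p. \<phi> (filtermap s p))"
  unfolding corona_continuous_def
proof (intro ballI allI impI)
  fix p and \<epsilon> :: real assume "p \<in> corona" and "\<epsilon> > 0"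
  then obtain E where "eventually E (filtermap s p)"
    "\<forall>q\<in>corona. eventually E q \<longrightarrow> \<bar>\<phi> q - \<phi> (filtermap s p)\<bar> < \<epsilon>"
    using \<phi> filtermap_corona [of p s] s unfolding corona_continuous_def by blast
  then show "\<exists>E. eventually E p \<and> (\<forall>q\<in>corona. eventually E q \<longrightarrow>
      \<bar>\<phi> (filtermap s q) - \<phi> (filtermap s p)\<bar> < \<epsilon>)"
    using filtermap_corona s
    by (intro exI [of _ "\<lambda>d. E (s d)"]) (auto simp: eventually_filtermap)
qed

lemma most_rows_sigma:
  "(\<And>n::nat. eventually (P n) most_rows) \<Longrightarrow> eventually (\<lambda>x. \<forall>n. P n x) most_rows"
  by (rule eventually_cosmall_all) (auto intro: card_of_mono1)

text \<open>The index set is the set of all rows: exceptional columns of all rows together are still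
  negligible, which fails with the roles exchanged.\<close>

lemma most_columns_sigma:
  "(\<And>a::nat set. eventually (P a) most_columns) \<Longrightarrow> eventually (\<lambda>x. \<forall>a. P a x) most_columns"
  by (rule eventually_cosmall_all) (auto simp: infinite_UNIV_nat_set intro: card_of_mono1)

lemma most_columns_sigma_nat:
  assumes "\<And>n::nat. eventually (P n) most_columns"
  shows "eventually (\<lambda>x. \<forall>n. P n x) most_columns"
proof -
  \<comment> \<open>\<open>Min\<close> maps the sets of naturals onto the naturals, through
    singletons, so the countable case follows from the larger one.\<close>
  have "eventually (\<lambda>x. \<forall>a. P (Min a) x) most_columns"
    by (intro most_columns_sigma assms)
  then show ?thesis
    by eventually_elim (metis Min_singleton)
qed

text \<open>Reduces the topology to functions on single copies. Clopen sets, signs and the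
  separating ramp are all handled through this criterion.\<close>

lemma continuous_map_plank:
  "continuous_map plank_topology euclideanreal f \<longleftrightarrow>
     (\<forall>a b. corona_continuous (\<lambda>p. f (Point a b p))) \<and>
     (\<forall>a. corona_continuous (\<lambda>p. f (Row a p)) \<and>
       (\<forall>\<^sub>F b in most_columns. \<forall>q\<in>corona. f (Point a b q) = f (Row a (filtermap ceiling_half q)))) \<and>
     (\<forall>b. corona_continuous (\<lambda>p. f (Column b p)) \<and>
       (\<forall>\<^sub>F a in most_rows. \<forall>q\<in>corona. f (Point a b q) = f (Column b (filtermap floor_half q))))"
    (is "_ \<longleftrightarrow> ?P \<and> ?R \<and> ?C")
proof -
  have "continuous_map plank_topology euclideanreal f \<longleftrightarrow>
     (\<forall>a b. \<forall>p\<in>corona. \<forall>\<epsilon>>0. nbhd (Point a b p) {y \<in> plank. \<bar>f y - f (Point a b p)\<bar> < \<epsilon>}) \<and>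
     (\<forall>a. \<forall>p\<in>corona. \<forall>\<epsilon>>0. nbhd (Row a p) {y \<in> plank. \<bar>f y - f (Row a p)\<bar> < \<epsilon>}) \<and>
     (\<forall>b. \<forall>p\<in>corona. \<forall>\<epsilon>>0. nbhd (Column b p) {y \<in> plank. \<bar>f y - f (Column b p)\<bar> < \<epsilon>})"
    unfolding continuous_map_plank_nbhd by (rule ball_plank)
  also have "(\<forall>a b. \<forall>p\<in>corona. \<forall>\<epsilon>>0. nbhd (Point a b p) {y \<in> plank. \<bar>f y - f (Point a b p)\<bar> < \<epsilon>}) \<longleftrightarrow> ?P"
    by (simp add: corona_continuous_def plank_def cong: conj_cong ball_cong)
  also have "(\<forall>a. \<forall>p\<in>corona. \<forall>\<epsilon>>0. nbhd (Row a p) {y \<in> plank. \<bar>f y - f (Row a p)\<bar> < \<epsilon>}) \<longleftrightarrow> ?R"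
    unfolding nbhd.simps
    by (subst fan_nbhd_continuous_iff) (simp_all add: most_columns_sigma_nat plank_def)
  also have "(\<forall>b. \<forall>p\<in>corona. \<forall>\<epsilon>>0. nbhd (Column b p) {y \<in> plank. \<bar>f y - f (Column b p)\<bar> < \<epsilon>}) \<longleftrightarrow> ?C"
    unfolding nbhd.simps
    by (subst fan_nbhd_continuous_iff) (simp_all add: most_rows_sigma plank_def)
  finally show ?thesis .
qed

section \<open>Separation, zero-dimensionality and the \<open>F\<close>-property of the
  plank\<close>

lemma ultra_separate:
  assumes "ultra p" "ultra q" "p \<noteq> q"
  obtains E where "eventually E p" "\<not> eventually E q"
  using assms ultra_le_eq [of q p] by (metis filter_leI)

lemma eventually_most_rows_neq: "eventually (\<lambda>a. a \<noteq> c) most_rows"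
  by (rule eventually_cosmall_neq) simp

lemma eventually_most_columns_neq: "eventually (\<lambda>b. b \<noteq> c) most_columns"
  by (rule eventually_cosmall_neq) (simp add: infinite_UNIV_nat_set)

lemma t1_space_plank: "t1_space plank_topology"
proof -
  have "openin plank_topology (plank - {y})" if y: "y \<in> plank" for y
    unfolding openin_plank
  proof (intro conjI ballI)
    fix x assume "x \<in> plank - {y}"
    then have x: "x \<in> plank" "x \<noteq> y"
      by auto
    \<comment> \<open>If the germs agree, \<open>x\<close> and \<open>y\<close> lie over different
      positions and \<open>E\<close> can be trivial; otherwise \<open>E\<close> separates the
      germs.\<close>
    obtain E where E: "eventually E (germ x)"
      and Ey: "eventually E (germ y) \<Longrightarrow> germ y = germ x"
    proof (cases "germ x = germ y")
      case True
      then show ?thesis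
        using that [of "\<lambda>_. True"] by simp
    next
      case False
      then show ?thesis
        using that x y ultra_separate [of "germ x" "germ y"] coronaD(1) by (auto simp: plank_def)
    qed
    show "nbhd x (plank - {y})"
    proof (cases x)
      case (Point a b p)
      then show ?thesis
        using E Ey x unfolding Point nbhd.simps by (intro exI [of _ E]) (auto simp: plank_def)
    next
      case (Row a p)
      \<comment> \<open>If \<open>y\<close> lies over the rectangle, \<open>c\<close> is its column;
        leaving out that one column keeps the neighbourhood away from \<open>y\<close>.\<close>
      obtain c where c: "\<And>a b q. y = Point a b q \<Longrightarrow> b = c"
        by (cases y) auto
      have "\<forall>\<^sub>F b in most_columns. \<forall>q\<in>corona.
          eventually (\<lambda>d. E (ceiling_half d)) q \<longrightarrow> Point a b q \<in> plank - {y}"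
        using eventually_most_columns_neq [of c]
        by eventually_elim (use c in \<open>auto simp: plank_def\<close>)
      then show ?thesis
        using E Ey x unfolding Row nbhd.simps fan_nbhd_def
        by (intro exI [of _ E]) (auto simp: plank_def)
    next
      case (Column b p)
      obtain c where c: "\<And>a b q. y = Point a b q \<Longrightarrow> a = c"
        by (cases y) auto
      have "\<forall>\<^sub>F a in most_rows. \<forall>q\<in>corona.
          eventually (\<lambda>d. E (floor_half d)) q \<longrightarrow> Point a b q \<in> plank - {y}"
        using eventually_most_rows_neq [of c]
        by eventually_elim (use c in \<open>auto simp: plank_def\<close>)
      then show ?thesis
        using E Ey x unfolding Column nbhd.simps fan_nbhd_def
        by (intro exI [of _ E]) (auto simp: plank_def)
    qed
  qed blast
  then show ?thesis
    unfolding t1_space_def by (metis DiffD2 DiffI singletonD singletonI topspace_plank)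
qed

text \<open>An ultrafilter not containing \<open>E\<close> contains its complement, so the basic
  sets are clopen; \<open>c\<close> records whether the copy at hand meets the set.\<close>

lemma corona_continuous_indicator:
  assumes S: "\<And>p. p \<in> corona \<Longrightarrow> S p \<longleftrightarrow> c \<and> eventually E p"
  shows "corona_continuous (\<lambda>p. of_bool (S p))"
  unfolding corona_continuous_def
proof (intro ballI allI impI)
  fix p and \<epsilon> :: real assume p: "p \<in> corona" and "\<epsilon> > 0"
  show "\<exists>E'. eventually E' p \<and> (\<forall>q\<in>corona. eventually E' q \<longrightarrow>
      \<bar>of_bool (S q) - of_bool (S p) :: real\<bar> < \<epsilon>)"
  proof (cases "eventually E p")
    case True
    then show ?thesis
      using \<open>\<epsilon> > 0\<close> p S by (intro exI [of _ E]) simp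
  next
    case False
    then show ?thesis
      using \<open>\<epsilon> > 0\<close> p S coronaD(1)
      by (intro exI [of _ "\<lambda>d. \<not> E d"]) (simp add: ultra_not)
  qed
qed

lemma corona_continuous_const: "corona_continuous (\<lambda>p. c)"
  unfolding corona_continuous_def by (auto intro: exI [of _ "\<lambda>_. True"])

lemma continuous_map_indicator_iff:
  assumes "C \<subseteq> topspace X"
  shows "continuous_map X euclideanreal (\<lambda>x. of_bool (x \<in> C)) \<longleftrightarrow> openin X C \<and> closedin X C"
proof
  let ?f = "\<lambda>x. of_bool (x \<in> C) :: real"
  assume f: "continuous_map X euclideanreal ?f"
  have "openin X {x \<in> topspace X. ?f x \<in> - {0}}" "closedin X {x \<in> topspace X. ?f x \<in> {1}}"
    using openin_continuous_map_preimage [OF f, of "- {0}"] closedin_continuous_map_preimage [OF f, of "{1}"]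
    by auto
  moreover have "{x \<in> topspace X. ?f x \<in> - {0}} = C" "{x \<in> topspace X. ?f x \<in> {1}} = C"
    using assms by auto
  ultimately show "openin X C \<and> closedin X C"
    by simp
next
  let ?f = "\<lambda>x. of_bool (x \<in> C) :: real"
  assume C: "openin X C \<and> closedin X C"
  have "openin X {x \<in> topspace X. ?f x \<in> V}" for V
  proof -
    have "{x \<in> topspace X. ?f x \<in> V} = (if 1 \<in> V then C else {}) \<union> (if 0 \<in> V then topspace X - C else {})"
      using assms by auto
    then show ?thesis
      using C by auto
  qed
  then show "continuous_map X euclideanreal ?f"
    by (simp add: continuous_map_def)
qed

text \<open>A set inside one row meets each column in a single copy, which is negligible there. So
  the limit condition need only be checked along that row, and symmetrically for columns.\<close>

lemma zero_dimensional_plank: "zero_dimensional_space plank_topology"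
proof -
  let ?clopen = "\<lambda>C. openin plank_topology C \<and> closedin plank_topology C"
  have "\<exists>C. ?clopen C \<and> x \<in> C \<and> C \<subseteq> U" if U: "openin plank_topology U" and x: "x \<in> U" for U x
  proof -
    have nb: "nbhd x U" and "x \<in> plank"
      using U x by (auto simp: openin_plank)
    have clopenI: "?clopen C" if "C \<subseteq> plank" "continuous_map plank_topology euclideanreal (\<lambda>x. of_bool (x \<in> C))" for C
      using continuous_map_indicator_iff [of C plank_topology] that by simp
    show ?thesis
    proof (cases x)
      case (Point a b p)
      obtain E where E: "eventually E p" "\<forall>q\<in>corona. eventually E q \<longrightarrow> Point a b q \<in> U"
        using nb by (auto simp: Point)
      let ?C = "{y \<in> plank. \<exists>q. y = Point a b q \<and> eventually E q}"
      have "continuous_map plank_topology euclideanreal (\<lambda>x. of_bool (x \<in> ?C))"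
        unfolding continuous_map_plank
      proof (intro conjI allI)
        fix a' b'
        show "corona_continuous (\<lambda>p. of_bool (Point a' b' p \<in> ?C))"
          by (rule corona_continuous_indicator [where c = "a' = a \<and> b' = b" and E = "E"])
            (auto simp: plank_def)
      next
        fix a'
        show "\<forall>\<^sub>F b' in most_columns. \<forall>q\<in>corona. of_bool (Point a' b' q \<in> ?C) =
            (of_bool (Row a' (filtermap ceiling_half q) \<in> ?C) :: real)"
          using eventually_most_columns_neq [of b] by eventually_elim simp
      next
        fix b'
        show "\<forall>\<^sub>F a' in most_rows. \<forall>q\<in>corona. of_bool (Point a' b' q \<in> ?C) =
            (of_bool (Column b' (filtermap floor_half q) \<in> ?C) :: real)"
          using eventually_most_rows_neq [of a] by eventually_elim simp
      qed (simp_all add: corona_continuous_const)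
      then have "?clopen ?C"
        by (intro clopenI) auto
      moreover have "x \<in> ?C" "?C \<subseteq> U"
        using E \<open>x \<in> plank\<close> by (auto simp: Point plank_def)
      ultimately show ?thesis
        by blast
    next
      case (Row a p)
      obtain E where E: "eventually E p" "\<forall>q\<in>corona. eventually E q \<longrightarrow> Row a q \<in> U"
        and ev: "\<forall>\<^sub>F b in most_columns. \<forall>q\<in>corona.
            eventually (\<lambda>d. E (ceiling_half d)) q \<longrightarrow> Point a b q \<in> U"
        using nb by (auto simp: Row fan_nbhd_def)
      \<comment> \<open>Only columns whose part of the neighbourhood lies entirely in
        \<open>U\<close> are kept; by \<open>ev\<close> these are most columns.\<close>
      define G where "G = {b. \<forall>q\<in>corona. eventually (\<lambda>d. E (ceiling_half d)) q \<longrightarrow> Point a b q \<in> U}"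
      let ?C = "{y \<in> plank. (\<exists>q. y = Row a q \<and> eventually E q) \<or>
        (\<exists>b q. y = Point a b q \<and> b \<in> G \<and> eventually (\<lambda>d. E (ceiling_half d)) q)}"
      have "continuous_map plank_topology euclideanreal (\<lambda>x. of_bool (x \<in> ?C))"
        unfolding continuous_map_plank
      proof (intro conjI allI)
        fix a' b
        show "corona_continuous (\<lambda>p. of_bool (Point a' b p \<in> ?C))"
          by (rule corona_continuous_indicator [where c = "a' = a \<and> b \<in> G" and E = "\<lambda>d. E (ceiling_half d)"])
            (auto simp: plank_def)
      next
        fix a'
        show "corona_continuous (\<lambda>p. of_bool (Row a' p \<in> ?C))"
          by (rule corona_continuous_indicator [where c = "a' = a" and E = "E"])
            (auto simp: plank_def)
        show "\<forall>\<^sub>F b in most_columns. \<forall>q\<in>corona. of_bool (Point a' b q \<in> ?C) =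
            (of_bool (Row a' (filtermap ceiling_half q) \<in> ?C) :: real)"
          using ev
        proof eventually_elim
          case (elim b)
          then have "b \<in> G"
            by (simp add: G_def)
          then show ?case
            by (auto simp: plank_def eventually_filtermap filtermap_corona)
        qed
      next
        fix b
        show "\<forall>\<^sub>F a' in most_rows. \<forall>q\<in>corona. of_bool (Point a' b q \<in> ?C) =
            (of_bool (Column b (filtermap floor_half q) \<in> ?C) :: real)"
          using eventually_most_rows_neq [of a] by eventually_elim simp
      qed (simp_all add: corona_continuous_const)
      then have "?clopen ?C"
        by (intro clopenI) auto
      moreover have "x \<in> ?C" "?C \<subseteq> U"
        using E \<open>x \<in> plank\<close> by (auto simp: Row plank_def G_def)
      ultimately show ?thesis
        by blast
    next
      case (Column b p)
      obtain E where E: "eventually E p" "\<forall>q\<in>corona. eventually E q \<longrightarrow> Column b q \<in> U"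
        and ev: "\<forall>\<^sub>F a in most_rows. \<forall>q\<in>corona.
            eventually (\<lambda>d. E (floor_half d)) q \<longrightarrow> Point a b q \<in> U"
        using nb by (auto simp: Column fan_nbhd_def)
      define G where "G = {a. \<forall>q\<in>corona. eventually (\<lambda>d. E (floor_half d)) q \<longrightarrow> Point a b q \<in> U}"
      let ?C = "{y \<in> plank. (\<exists>q. y = Column b q \<and> eventually E q) \<or>
        (\<exists>a q. y = Point a b q \<and> a \<in> G \<and> eventually (\<lambda>d. E (floor_half d)) q)}"
      have "continuous_map plank_topology euclideanreal (\<lambda>x. of_bool (x \<in> ?C))"
        unfolding continuous_map_plank
      proof (intro conjI allI)
        fix a b'
        show "corona_continuous (\<lambda>p. of_bool (Point a b' p \<in> ?C))"
          by (rule corona_continuous_indicator [where c = "b' = b \<and> a \<in> G" and E = "\<lambda>d. E (floor_half d)"])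
            (auto simp: plank_def)
      next
        fix b'
        show "corona_continuous (\<lambda>p. of_bool (Column b' p \<in> ?C))"
          by (rule corona_continuous_indicator [where c = "b' = b" and E = "E"])
            (auto simp: plank_def)
        show "\<forall>\<^sub>F a in most_rows. \<forall>q\<in>corona. of_bool (Point a b' q \<in> ?C) =
            (of_bool (Column b' (filtermap floor_half q) \<in> ?C) :: real)"
          using ev
        proof eventually_elim
          case (elim a)
          then have "a \<in> G"
            by (simp add: G_def)
          then show ?case
            by (auto simp: plank_def eventually_filtermap filtermap_corona)
        qed
      next
        fix a
        show "\<forall>\<^sub>F b' in most_columns. \<forall>q\<in>corona. of_bool (Point a b' q \<in> ?C) =
            (of_bool (Row a (filtermap ceiling_half q) \<in> ?C) :: real)"
          using eventually_most_columns_neq [of b] by eventually_elim simp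
      qed (simp_all add: corona_continuous_const)
      then have "?clopen ?C"
        by (intro clopenI) auto
      moreover have "x \<in> ?C" "?C \<subseteq> U"
        using E \<open>x \<in> plank\<close> by (auto simp: Column plank_def G_def)
      ultimately show ?thesis
        by blast
    qed
  qed
  then have "openin plank_topology U \<longleftrightarrow> (arbitrary union_of ?clopen) U" for U
    unfolding arbitrary_union_of_alt by (meson openin_subopen)
  then show ?thesis
    unfolding zero_dimensional_space_def using t1_space_plank by blast
qed

text \<open>The sign function is chosen as one operator \<open>K\<close> on functions on the corona that preserves
  invariance under \<open>double \<circ> floor_half\<close> and \<open>double \<circ> ceiling_half\<close>. As all but few copies carry the
  pullback of the limit copy, applying \<open>K\<close> copy by copy then automatically fits together.\<close>

lemma F_space_plank: "F_space plank_topology"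
  unfolding F_space_def
proof (intro allI impI)
  fix f assume f: "continuous_map plank_topology euclideanreal f"
  \<comment> \<open>Rescaling to absolute value at most 1 preserves the sign and makes the bounded
    theory of the corona applicable.\<close>
  define f1 where "f1 x = f x / (1 + \<bar>f x\<bar>)" for x
  have pos: "1 + \<bar>f x\<bar> > 0" for x
    by (simp add: add_pos_nonneg)
  have "continuous_map plank_topology euclideanreal f1"
    unfolding f1_def using f
    by (intro continuous_map_real_divide continuous_intros) (use pos in \<open>auto simp: less_imp_neq [symmetric]\<close>)
  then have P: "corona_continuous (\<lambda>p. f1 (Point a b p))"
    and R: "corona_continuous (\<lambda>p. f1 (Row a p))"
    and C: "corona_continuous (\<lambda>p. f1 (Column b p))"
    and PR: "\<forall>\<^sub>F b in most_columns. \<forall>q\<in>corona. f1 (Point a b q) = f1 (Row a (filtermap ceiling_half q))"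
    and PC: "\<forall>\<^sub>F a in most_rows. \<forall>q\<in>corona. f1 (Point a b q) = f1 (Column b (filtermap floor_half q))" for a b
    unfolding continuous_map_plank by blast+
  have f1: "\<bar>f1 x\<bar> \<le> 1" for x
    by (simp add: f1_def divide_simps)
  define J where "J = {double \<circ> floor_half, double \<circ> ceiling_half}"
  define Q where "Q \<phi> \<kappa> \<longleftrightarrow> corona_continuous \<kappa> \<and> (\<forall>p\<in>corona. \<phi> p = \<kappa> p * \<bar>\<phi> p\<bar>) \<and>
    (\<forall>e\<in>J. (\<forall>p\<in>corona. \<phi> (filtermap e p) = \<phi> p) \<longrightarrow> (\<forall>p\<in>corona. \<kappa> (filtermap e p) = \<kappa> p))"
    for \<phi> \<kappa> :: "(nat \<times> nat) filter \<Rightarrow> real"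
  \<comment> \<open>Setting \<phi> to 0 off the corona makes the choice depend only on its values on
    the corona, which gives \<open>K_cong\<close>.\<close>
  define K where "K \<phi> = (SOME \<kappa>. Q (\<lambda>p. if p \<in> corona then \<phi> p else 0) \<kappa>)" for \<phi>
  have Q: "Q \<phi> (K \<phi>)" if "corona_continuous \<phi>" "\<And>p. \<bar>\<phi> p\<bar> \<le> 1" for \<phi>
  proof -
    let ?\<phi> = "\<lambda>p. if p \<in> corona then \<phi> p else 0"
    have "\<exists>\<kappa>. Q ?\<phi> \<kappa>"
      unfolding Q_def
    proof (rule corona_sign)
      show "corona_continuous ?\<phi>"
        using that(1) by (rule corona_continuous_cong [THEN iffD1, rotated]) simp
    qed (use that in \<open>auto simp: J_def\<close>)
    then have "Q ?\<phi> (K \<phi>)"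
      unfolding K_def by (rule someI_ex)
    moreover have "filtermap e p \<in> corona" if "e \<in> J" "p \<in> corona" for e p
      using that by (auto simp: J_def intro: filtermap_corona)
    ultimately show ?thesis
      by (simp add: Q_def)
  qed
  have K_cong: "K \<phi> = K \<psi>" if "\<And>p. p \<in> corona \<Longrightarrow> \<phi> p = \<psi> p" for \<phi> \<psi>
    using that unfolding K_def by (intro arg_cong [where f = Eps]) (auto cong: if_cong)
  \<comment> \<open>The sign of a pullback along \<open>s\<close> is invariant under
    \<open>double \<circ> s\<close>, hence is itself a pullback along \<open>s\<close>; composing
    with \<open>double\<close> recovers the function on the limit copy.\<close>
  define wing where "wing s \<phi> p = K (\<lambda>q. \<phi> (filtermap s q)) (filtermap double p)"
    for s :: "nat \<times> nat \<Rightarrow> nat \<times> nat" and \<phi> p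
  have wing: "corona_continuous (wing s \<phi>)" "\<And>p. p \<in> corona \<Longrightarrow> \<phi> p = wing s \<phi> p * \<bar>\<phi> p\<bar>"
      "\<And>q. q \<in> corona \<Longrightarrow> K (\<lambda>q. \<phi> (filtermap s q)) q = wing s \<phi> (filtermap s q)"
    if s: "s = floor_half \<or> s = ceiling_half" and \<phi>: "corona_continuous \<phi>" "\<And>p. \<bar>\<phi> p\<bar> \<le> 1" for s \<phi>
  proof -
    have fst_s: "fst (s d) = fst d" and sd: "s (double d) = d" and J: "double \<circ> s \<in> J" for d
      using s by (auto simp: J_def)
    have Qs: "Q (\<lambda>q. \<phi> (filtermap s q)) (K (\<lambda>q. \<phi> (filtermap s q)))"
      by (rule Q) (simp_all add: corona_continuous_filtermap \<phi> fst_s)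
    then show "corona_continuous (wing s \<phi>)"
      unfolding wing_def by (intro corona_continuous_filtermap) (simp_all add: Q_def)
    have "filtermap s (filtermap double p) = p" for p
      by (simp add: filtermap_filtermap sd)
    with Qs show "\<phi> p = wing s \<phi> p * \<bar>\<phi> p\<bar>" if "p \<in> corona" for p
      using filtermap_corona [of p double] that unfolding wing_def Q_def
      by (metis fst_half_double(3))
    show "K (\<lambda>q. \<phi> (filtermap s q)) q = wing s \<phi> (filtermap s q)" if "q \<in> corona" for q
    proof -
      have "\<forall>p\<in>corona. \<phi> (filtermap s (filtermap (double \<circ> s) p)) = \<phi> (filtermap s p)"
        by (simp add: filtermap_filtermap sd)
      then have "K (\<lambda>q. \<phi> (filtermap s q)) (filtermap (double \<circ> s) q) = K (\<lambda>q. \<phi> (filtermap s q)) q"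
        using Qs J that unfolding Q_def by blast
      then show ?thesis
        by (simp add: wing_def filtermap_filtermap comp_def)
    qed
  qed
  define k where "k x = (case x of Point a b p \<Rightarrow> K (\<lambda>q. f1 (Point a b q)) p
    | Row a p \<Rightarrow> wing ceiling_half (\<lambda>q. f1 (Row a q)) p
    | Column b p \<Rightarrow> wing floor_half (\<lambda>q. f1 (Column b q)) p)" for x
  have "continuous_map plank_topology euclideanreal k"
    unfolding continuous_map_plank
  proof (intro conjI allI)
    fix a b
    show "corona_continuous (\<lambda>p. k (Point a b p))"
      using Q [OF P f1] by (simp add: k_def Q_def)
    show "corona_continuous (\<lambda>p. k (Row a p))" "corona_continuous (\<lambda>p. k (Column b p))"
      using wing(1) [OF _ R f1] wing(1) [OF _ C f1] by (simp_all add: k_def)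
    show "\<forall>\<^sub>F b in most_columns. \<forall>q\<in>corona. k (Point a b q) = k (Row a (filtermap ceiling_half q))"
      using PR [of a]
    proof eventually_elim
      case (elim b)
      then have "K (\<lambda>q. f1 (Point a b q)) = K (\<lambda>q. f1 (Row a (filtermap ceiling_half q)))"
        by (intro K_cong) blast
      then show ?case
        using wing(3) [OF _ R f1] by (simp add: k_def)
    qed
    show "\<forall>\<^sub>F a in most_rows. \<forall>q\<in>corona. k (Point a b q) = k (Column b (filtermap floor_half q))"
      using PC [of b]
    proof eventually_elim
      case (elim a)
      then have "K (\<lambda>q. f1 (Point a b q)) = K (\<lambda>q. f1 (Column b (filtermap floor_half q)))"
        by (intro K_cong) blast
      then show ?case
        using wing(3) [OF _ C f1] by (simp add: k_def)
    qed
  qed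
  moreover have "f x = k x * \<bar>f x\<bar>" if "x \<in> plank" for x
  proof -
    have "f1 x = k x * \<bar>f1 x\<bar>"
    proof (cases x)
      case (Point a b p)
      with Q [OF P f1] that show ?thesis
        by (auto simp: k_def Q_def plank_def)
    next
      case (Row a p)
      with wing(2) [OF _ R f1] that show ?thesis
        by (simp add: k_def plank_def)
    next
      case (Column b p)
      with wing(2) [OF _ C f1] that show ?thesis
        by (simp add: k_def plank_def)
    qed
    then show ?thesis
      using pos [of x] by (simp add: f1_def abs_divide)
  qed
  ultimately show "\<exists>k. continuous_map plank_topology euclideanreal k \<and>
      (\<forall>x\<in>topspace plank_topology. f x = k x * \<bar>f x\<bar>)"
    unfolding topspace_plank by blast
qed

section \<open>Failure of strong zero-dimensionality\<close>

lemma tendsto_levels_over_Suc: "((\<lambda>d. c / real (Suc (fst d))) \<longlongrightarrow> 0) levels"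
proof -
  have "(\<lambda>n. c * (1 / real (Suc n))) \<longlonglongrightarrow> c * 0"
    by (intro tendsto_intros LIMSEQ_Suc [OF lim_1_over_n])
  then show ?thesis
    unfolding levels_def
    by (intro filterlim_compose [OF _ filterlim_filtercomap, of "\<lambda>n. c / real (Suc n)"]) simp
qed

text \<open>Being almost invariant under both maps forces almost equal values at neighbours.\<close>

lemma half_double_cases:
  "\<exists>e\<in>{double \<circ> floor_half, double \<circ> ceiling_half}.
     e (n, i) = (n, Suc i) \<or> e (n, Suc i) = (n, i)"
proof (cases "even i")
  case True
  then show ?thesis
    by (intro bexI [of _ "double \<circ> floor_half"]) (auto simp: floor_half_def double_def)
next
  case False
  then show ?thesis
    by (intro bexI [of _ "double \<circ> ceiling_half"]) (auto simp: ceiling_half_def double_def)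
qed

text \<open>On level \<open>n\<close> it climbs from -1 to 1 in \<open>n + 1\<close> equal steps,
  whose size tends to 0 with growing \<open>n\<close>.\<close>

definition ramp :: "nat \<times> nat \<Rightarrow> real" where
  "ramp d = 2 * min 1 (real (snd d) / real (Suc (fst d))) - 1"

lemma ramp_bounds: "- 1 \<le> ramp d" "ramp d \<le> 1" "\<bar>ramp d\<bar> \<le> 1"
proof -
  show 1: "- 1 \<le> ramp d" and 2: "ramp d \<le> 1"
    by (auto simp: ramp_def min_def)
  from 1 2 show "\<bar>ramp d\<bar> \<le> 1"
    by (simp add: abs_le_iff)
qed

text \<open>Both maps move the second coordinate by at most 1, hence the ramp by at most one
  step.\<close>

lemma ramp_slow:
  assumes "e = double \<circ> floor_half \<or> e = double \<circ> ceiling_half"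
  shows "((\<lambda>d. ramp (e d) - ramp d) \<longlongrightarrow> 0) levels"
proof (rule Lim_null_comparison [OF _ tendsto_levels_over_Suc [of 2]], rule always_eventually, rule allI)
  fix d :: "nat \<times> nat"
  let ?n = "real (Suc (fst d))"
  have "fst (e d) = fst d" and i: "\<bar>real (snd (e d)) - real (snd d)\<bar> \<le> 1"
    using assms by (auto simp: double_def floor_half_def ceiling_half_def)
  then have "\<bar>real (snd (e d)) / ?n - real (snd d) / ?n\<bar> \<le> 1 / ?n"
    unfolding diff_divide_distrib [symmetric] abs_divide by (simp add: divide_right_mono)
  then have "\<bar>min 1 (real (snd (e d)) / ?n) - min 1 (real (snd d) / ?n)\<bar> \<le> 1 / ?n"
    by (smt (verit))
  moreover have "2 / ?n = 2 * (1 / ?n)"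
    by simp
  ultimately show "norm (ramp (e d) - ramp d) \<le> 2 / ?n"
    unfolding ramp_def \<open>fst (e d) = fst d\<close> real_norm_def by argo
qed

text \<open>On the border, \<open>double\<close> compensates the halving: \<open>ramp\<close> after
  \<open>double\<close> and either halving map differs from \<open>ramp\<close> by a null
  function.\<close>

definition plank_ramp :: "point \<Rightarrow> real" where
  "plank_ramp x = (case x of Point a b p \<Rightarrow> Lim p ramp
     | Row a p \<Rightarrow> Lim p (\<lambda>d. ramp (double d)) | Column b p \<Rightarrow> Lim p (\<lambda>d. ramp (double d)))"

lemma continuous_map_plank_ramp:
  "continuous_map plank_topology (top_of_set {-1..1}) plank_ramp"
proof -
  have eq: "Lim q ramp = Lim (filtermap s q) (\<lambda>d. ramp (double d))"
    if "q \<in> corona" "s = floor_half \<or> s = ceiling_half" for q s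
    using Lim_cong_levels [OF that(1) ramp_bounds(3) ramp_slow [of "double \<circ> s"]] that(2)
    by (auto simp: Lim_filtermap)
  have "continuous_map plank_topology euclideanreal plank_ramp"
    unfolding continuous_map_plank plank_ramp_def
    using eq corona_continuous_Lim [where u = ramp, OF ramp_bounds(3)]
      corona_continuous_Lim [where u = "\<lambda>d. ramp (double d)", OF ramp_bounds(3)]
    by simp
  moreover have Lim: "Lim p (\<lambda>d. ramp (s d)) \<in> {-1..1}" if "p \<in> corona" for p s
  proof -
    have lim: "((\<lambda>d. ramp (s d)) \<longlongrightarrow> Lim p (\<lambda>d. ramp (s d))) p"
      by (rule corona_tendsto_Lim [OF that]) (rule ramp_bounds(3))
    show ?thesis
      using tendsto_lowerbound [OF lim, of "-1"] tendsto_upperbound [OF lim, of 1] coronaD(3) [OF that]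
      by (simp add: ramp_bounds)
  qed
  have "plank_ramp x \<in> {-1..1}" if "x \<in> plank" for x
    using that Lim [of "germ x" double] Lim [of "germ x" "\<lambda>d. d"]
    by (cases x) (auto simp: plank_ramp_def plank_def)
  ultimately show ?thesis
    by (auto simp: continuous_map_in_subtopology)
qed

lemma corona_germ_at_zero:
  obtains p where "p \<in> corona" "eventually (\<lambda>d. snd d = 0) p"
proof -
  have "inf levels (principal {d. snd d = 0}) \<noteq> bot"
    by (auto simp: trivial_limit_def eventually_inf_principal eventually_levels)
  then obtain p where "ultra p" "p \<le> inf levels (principal {d. snd d = 0})"
    by (rule ultra_exists)
  then show thesis
    using that by (auto simp: corona_def le_principal)
qed

lemma not_strongly_zero_dimensional_plank: "\<not> strongly_zero_dimensional plank_topology"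
proof
  assume szd: "strongly_zero_dimensional plank_topology"
  obtain p where p: "p \<in> corona" "eventually (\<lambda>d. snd d = 0) p"
    by (rule corona_germ_at_zero)
  \<comment> \<open>Moves the start of level \<open>n\<close> to position \<open>n + 1\<close>,
    where the ramp has reached 1.\<close>
  define r where "r d = (fst d, Suc (fst d))" for d :: "nat \<times> nat"
  define p' where "p' = filtermap r p"
  have p': "p' \<in> corona"
    unfolding p'_def using p(1) by (rule filtermap_corona) (simp add: r_def)
  have low: "plank_ramp (Point a b p) = -1" for a b
  proof -
    have "(ramp \<longlongrightarrow> -1) p"
      by (rule tendsto_eventually) (use p(2) in \<open>eventually_elim, simp add: ramp_def\<close>)
    then show ?thesis
      using coronaD(3) [OF p(1)] by (simp add: plank_ramp_def tendsto_Lim)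
  qed
  have high: "plank_ramp (Point a b p') = 1" for a b
  proof -
    have "(ramp \<longlongrightarrow> 1) p'"
      unfolding p'_def filterlim_filtermap
      by (rule tendsto_eventually) (simp add: ramp_def r_def)
    then show ?thesis
      using coronaD(3) [OF p'] by (simp add: plank_ramp_def tendsto_Lim)
  qed
  define A where "A = {x \<in> plank. plank_ramp x = -1}"
  define B where "B = {x \<in> plank. plank_ramp x = 1}"
  have AB: "Point a b p \<in> A" "Point a b p' \<in> B" for a b
    using p p' low high by (auto simp: A_def B_def plank_def)
  have "plank_ramp ` A = {-1}" "plank_ramp ` B = {1}"
    using AB by (auto simp: A_def B_def image_iff) metis+
  then have "completely_separated plank_topology A B"
    using continuous_map_plank_ramp unfolding completely_separated_def by blast
  moreover have "A \<subseteq> topspace plank_topology" "B \<subseteq> topspace plank_topology"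
    by (auto simp: A_def B_def)
  ultimately have "\<exists>C. openin plank_topology C \<and> closedin plank_topology C \<and> A \<subseteq> C \<and> C \<inter> B = {}"
    using szd by (simp only: strongly_zero_dimensional_def)
  then obtain C where C: "openin plank_topology C" "closedin plank_topology C" "A \<subseteq> C" "C \<inter> B = {}"
    by blast
  define f :: "point \<Rightarrow> real" where "f x = of_bool (x \<in> C)" for x
  have "continuous_map plank_topology euclideanreal f"
    using continuous_map_indicator_iff [of C plank_topology] C closedin_subset
    unfolding f_def [abs_def] by blast
  note f = this [unfolded continuous_map_plank]
  have "\<forall>\<^sub>F b in most_columns. \<forall>a. \<forall>q\<in>corona. f (Point a b q) = f (Row a (filtermap ceiling_half q))"
    using f by (intro most_columns_sigma) blast
  \<comment> \<open>The column comes first, one that is good for all rows at once; a row that is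
    good for this column is chosen afterwards.\<close>
  then obtain b where b: "\<And>a q. q \<in> corona \<Longrightarrow> f (Point a b q) = f (Row a (filtermap ceiling_half q))"
    using eventually_happens' [OF cosmall_neq_bot [OF infinite_UNIV_nat_set]] by blast
  have "\<forall>\<^sub>F a in most_rows. \<forall>q\<in>corona. f (Point a b q) = f (Column b (filtermap floor_half q))"
    using f by blast
  then obtain a where a: "\<And>q. q \<in> corona \<Longrightarrow> f (Point a b q) = f (Column b (filtermap floor_half q))"
    using eventually_happens' [OF cosmall_neq_bot [OF infinite_UNIV_nat]] by blast
  define \<phi> where "\<phi> q = f (Point a b q)" for q
  have \<phi>01: "\<phi> q = 0 \<or> \<phi> q = 1" for q
    by (simp add: \<phi>_def f_def)
  \<comment> \<open>On the chosen copy the function is a pullback along both halving maps, hence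
    invariant under both compositions with \<open>double\<close>.\<close>
  have \<phi>e: "\<phi> (filtermap e q) = \<phi> q" if "e \<in> {double \<circ> floor_half, double \<circ> ceiling_half}" "q \<in> corona" for e q
  proof -
    have "filtermap e q \<in> corona"
      using that by (auto intro: filtermap_corona)
    with that a b show ?thesis
      unfolding \<phi>_def by (fastforce simp: filtermap_filtermap)
  qed
  have "corona_continuous \<phi>"
    using f by (simp add: \<phi>_def [abs_def])
  moreover have "\<bar>\<phi> q\<bar> \<le> 1" for q
    using \<phi>01 [of q] by auto
  ultimately obtain g where g: "\<And>q. q \<in> corona \<Longrightarrow> (g \<longlongrightarrow> \<phi> q) q"
    using corona_continuous_represent [of \<phi>] by blast
  have slow: "eventually (\<lambda>d. \<bar>g (e d) - g d\<bar> < 1/4) levels"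
    if e: "e \<in> {double \<circ> floor_half, double \<circ> ceiling_half}" for e
  proof (rule eventually_levels_if_corona)
    fix q assume q: "q \<in> corona"
    then have "filtermap e q \<in> corona"
      using e by (auto intro: filtermap_corona)
    from g [OF this] have "((\<lambda>d. g (e d)) \<longlongrightarrow> \<phi> q) q"
      by (simp add: \<phi>e [OF e q] filterlim_filtermap)
    from tendsto_diff [OF this g [OF q]] have "((\<lambda>d. g (e d) - g d) \<longlongrightarrow> 0) q"
      by simp
    from tendstoD [OF this, of "1/4"] show "eventually (\<lambda>d. \<bar>g (e d) - g d\<bar> < 1/4) q"
      by simp
  qed
  have two: "eventually (\<lambda>d. \<bar>g d\<bar> < 1/4 \<or> \<bar>g d - 1\<bar> < 1/4) levels"
  proof (rule eventually_levels_if_corona)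
    fix q assume "q \<in> corona"
    from tendstoD [OF g [OF this], of "1/4"] \<phi>01 [of q]
    show "eventually (\<lambda>d. \<bar>g d\<bar> < 1/4 \<or> \<bar>g d - 1\<bar> < 1/4) q"
      by (auto simp: dist_real_def elim: eventually_mono)
  qed
  have "eventually (\<lambda>d. (\<bar>g d\<bar> < 1/4 \<or> \<bar>g d - 1\<bar> < 1/4) \<and>
      (\<forall>e\<in>{double \<circ> floor_half, double \<circ> ceiling_half}. \<bar>g (e d) - g d\<bar> < 1/4)) levels"
    using two slow [of "double \<circ> floor_half", simplified] slow [of "double \<circ> ceiling_half", simplified]
    by eventually_elim simp
  then obtain N where N: "\<And>n i. n \<ge> N \<Longrightarrow> \<bar>g (n, i)\<bar> < 1/4 \<or> \<bar>g (n, i) - 1\<bar> < 1/4"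
    "\<And>n i e. n \<ge> N \<Longrightarrow> e \<in> {double \<circ> floor_half, double \<circ> ceiling_half} \<Longrightarrow> \<bar>g (e (n, i)) - g (n, i)\<bar> < 1/4"
    unfolding eventually_levels by blast
  \<comment> \<open>Values near 0 and values near 1 are more than \<open>1/2\<close> apart, while
    neighbours differ by less than \<open>1/4\<close>; so no jump occurs along a level.\<close>
  have const: "\<bar>g (n, i) - 1\<bar> < 1/4 \<longleftrightarrow> \<bar>g (n, 0) - 1\<bar> < 1/4" if n: "n \<ge> N" for n i
  proof (induction i)
    case (Suc i)
    have "\<bar>g (n, Suc i) - g (n, i)\<bar> < 1/4"
    proof -
      obtain e where e: "e \<in> {double \<circ> floor_half, double \<circ> ceiling_half}"
        "e (n, i) = (n, Suc i) \<or> e (n, Suc i) = (n, i)"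
        using half_double_cases [of n i] by blast
      then show ?thesis
        using N(2) [OF n e(1), of i] N(2) [OF n e(1), of "Suc i"] by (auto simp: abs_minus_commute)
    qed
    then have "\<bar>g (n, Suc i) - 1\<bar> < 1/4 \<longleftrightarrow> \<bar>g (n, i) - 1\<bar> < 1/4"
      using N(1) [OF n, of i] N(1) [OF n, of "Suc i"] by (auto simp: abs_real_def split: if_splits)
    then show ?case
      using Suc by simp
  qed simp
  have "eventually (\<lambda>d. N \<le> fst d) levels"
    by (auto simp: eventually_levels)
  then have large: "eventually (\<lambda>d. N \<le> fst d) p"
    using p(1) by (rule eventually_levels_corona)
  have "Point a b p \<in> C" "Point a b p' \<notin> C"
    using AB C by blast+
  then have \<phi>p: "\<phi> p = 1" "\<phi> p' = 0"
    by (auto simp: \<phi>_def f_def)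
  have "eventually (\<lambda>d. \<bar>g d - 1\<bar> < 1/4) p"
    using tendstoD [OF g [OF p(1)], of "1/4"] by (simp add: \<phi>p dist_real_def)
  moreover have "eventually (\<lambda>d. \<bar>g (r d)\<bar> < 1/4) p"
    using tendstoD [OF g [OF p'], of "1/4"] by (simp add: \<phi>p) (simp add: p'_def eventually_filtermap)
  ultimately have "eventually (\<lambda>d. False) p"
    using large p(2)
  proof eventually_elim
    case (elim d)
    then have "\<bar>g (fst d, Suc (fst d)) - 1\<bar> < 1/4"
      using const [of "fst d" "Suc (fst d)"] by (cases d) simp
    then show False
      using elim(2) by (simp add: r_def)
  qed
  then show False
    using coronaD(3) [OF p(1)] by (simp add: trivial_limit_def)
qed

section \<open>Zero-dimensional spaces and compactifications\<close>

lemma zero_dimensional_base: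
  assumes "zero_dimensional_space X" "openin X U" "x \<in> U"
  obtains C where "openin X C" "closedin X C" "x \<in> C" "C \<subseteq> U"
proof -
  have "(arbitrary union_of (\<lambda>C. openin X C \<and> closedin X C)) U"
    using assms by (simp only: zero_dimensional_space_def)
  then show thesis
    unfolding arbitrary_union_of_alt using \<open>x \<in> U\<close> that by blast
qed

lemma zero_dimensional_imp_tychonoff:
  assumes "zero_dimensional_space X"
  shows "tychonoff_space X"
proof -
  have "\<exists>f. continuous_map X (top_of_set {0..1}) f \<and> f x = 0 \<and> f ` S \<subseteq> {1::real}"
    if S: "closedin X S" and x: "x \<in> topspace X - S" for S x
  proof -
    obtain C where C: "openin X C" "closedin X C" "x \<in> C" "C \<subseteq> topspace X - S"
      using zero_dimensional_base [OF assms _ x] S by (metis openin_diff openin_topspace)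
    then have "continuous_map X euclideanreal (\<lambda>x. of_bool (x \<in> topspace X - C))"
      by (subst continuous_map_indicator_iff) auto
    then have "continuous_map X (top_of_set {0..1}) (\<lambda>x. of_bool (x \<in> topspace X - C) :: real)"
      by (auto simp: continuous_map_in_subtopology)
    moreover have "(\<lambda>x. of_bool (x \<in> topspace X - C)) ` S \<subseteq> {1::real}"
      using C S closedin_subset by fastforce
    ultimately show ?thesis
      using C by (intro exI [of _ "\<lambda>x. of_bool (x \<in> topspace X - C)"]) auto
  qed
  then show ?thesis
    using assms by (simp add: tychonoff_space_def completely_regular_space_def zero_dimensional_space_def)
qed

lemma zero_dimensional_compact_separation:
  assumes X: "zero_dimensional_space X" and S: "compactin X S" "openin X U" "S \<subseteq> U"
  obtains C where "openin X C" "closedin X C" "S \<subseteq> C" "C \<subseteq> U"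
proof -
  define \<C> where "\<C> = {C. openin X C \<and> closedin X C \<and> C \<subseteq> U}"
  have "S \<subseteq> \<Union>\<C>"
  proof
    fix x assume "x \<in> S"
    with S have "x \<in> U"
      by blast
    then show "x \<in> \<Union>\<C>"
      by (rule zero_dimensional_base [OF X \<open>openin X U\<close>]) (auto simp: \<C>_def)
  qed
  then obtain \<F> where "finite \<F>" "\<F> \<subseteq> \<C>" "S \<subseteq> \<Union>\<F>"
    using compactinD [OF S(1), of \<C>] by (auto simp: \<C>_def)
  then show thesis
    by (intro that [of "\<Union>\<F>"]) (auto simp: \<C>_def subset_iff intro!: openin_Union closedin_Union)
qed

text \<open>The separating function extends to the compactification, where the compact zero set of
  the extension is enclosed in a clopen set on which the extension stays below 1; its preimage
  separates \<open>A\<close> and \<open>B\<close>.\<close>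

lemma strongly_zero_dimensional_if_cech_stone:
  assumes X: "tychonoff_space X" and \<beta>: "zero_dimensional_space (cech_stone X)"
  shows "strongly_zero_dimensional X"
  unfolding strongly_zero_dimensional_def
proof (intro allI impI, elim conjE)
  fix A B assume AB: "A \<subseteq> topspace X" "B \<subseteq> topspace X" and "completely_separated X A B"
  then obtain f where f: "continuous_map X (top_of_set {-1..1::real}) f" "f ` A = {-1}" "f ` B = {1}"
    by (auto simp: completely_separated_def)
  \<comment> \<open>Rescaled from \<open>[-1,1]\<close> to \<open>[0,1]\<close>, the range used to
    build the compactification.\<close>
  have "continuous_map X euclideanreal (\<lambda>x. (f x + 1) / 2)"
    using f(1) by (intro continuous_intros) (auto simp: continuous_map_in_subtopology)
  moreover have "(f x + 1) / 2 \<in> {0..1}" if "x \<in> topspace X" for x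
    using f(1) that by (force simp: continuous_map_in_subtopology image_subset_iff Pi_iff)
  ultimately have "continuous_map X (top_of_set {0..1}) (\<lambda>x. (f x + 1) / 2)"
    by (auto simp: continuous_map_in_subtopology)
  then obtain g where g: "continuous_map (cech_stone X) (top_of_set {0..1::real}) g"
      "\<And>x. x \<in> topspace X \<Longrightarrow> g (beta_eval X x) = (f x + 1) / 2"
    by (rule cech_stone_extension) blast
  then have g': "continuous_map (cech_stone X) euclideanreal g"
    by (simp add: continuous_map_in_subtopology)
  let ?U = "{z \<in> topspace (cech_stone X). g z \<in> {..<1}}"
  let ?S = "{z \<in> topspace (cech_stone X). g z \<in> {0}}"
  have opn: "openin (cech_stone X) ?U"
    by (rule openin_continuous_map_preimage [OF g']) simp
  have cpt: "compactin (cech_stone X) ?S"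
    by (intro closedin_compact_space compact_space_cech_stone closedin_continuous_map_preimage [OF g']) simp
  obtain C where C: "openin (cech_stone X) C" "closedin (cech_stone X) C" "?S \<subseteq> C" "C \<subseteq> ?U"
    by (rule zero_dimensional_compact_separation [OF \<beta> cpt opn]) auto
  have e: "continuous_map X (cech_stone X) (beta_eval X)"
    using homeomorphic_imp_continuous_map embedding_map_beta_eval [OF X]
    by (fastforce simp: embedding_map_def continuous_map_in_subtopology)
  then have eX: "beta_eval X x \<in> topspace (cech_stone X)" if "x \<in> topspace X" for x
    using that by (auto simp: continuous_map_def)
  show "\<exists>C. openin X C \<and> closedin X C \<and> A \<subseteq> C \<and> C \<inter> B = {}"
  proof (intro exI conjI)
    let ?C = "{x \<in> topspace X. beta_eval X x \<in> C}"
    show "openin X ?C" "closedin X ?C"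
      using C openin_continuous_map_preimage [OF e] closedin_continuous_map_preimage [OF e] by auto
    have "f x = -1" if "x \<in> A" for x
      using f(2) that by blast
    then show "A \<subseteq> ?C"
      using AB C(3) g(2) eX by fastforce
    have "f x = 1" if "x \<in> B" for x
      using f(3) that by blast
    then show "?C \<inter> B = {}"
      using C(4) g(2) by fastforce
  qed
qed

section \<open>Homeomorphic copies\<close>

lemma F_space_homeomorphic:
  assumes h: "homeomorphic_maps X Y e g" and X: "F_space X"
  shows "F_space Y"
  unfolding F_space_def
proof (intro allI impI)
  fix f assume f: "continuous_map Y euclideanreal f"
  have e: "continuous_map X Y e" and g: "continuous_map Y X g" and eg: "\<And>y. y \<in> topspace Y \<Longrightarrow> e (g y) = y"
    using h by (auto simp: homeomorphic_maps_def)
  obtain k where k: "continuous_map X euclideanreal k"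
    "\<And>x. x \<in> topspace X \<Longrightarrow> (f \<circ> e) x = k x * \<bar>(f \<circ> e) x\<bar>"
    using X continuous_map_compose [OF e f] unfolding F_space_def by blast
  have "f y = (k \<circ> g) y * \<bar>f y\<bar>" if "y \<in> topspace Y" for y
  proof -
    have "g y \<in> topspace X"
      using g that by (auto simp: continuous_map_def)
    from k(2) [OF this] show ?thesis
      by (simp add: eg that)
  qed
  then show "\<exists>k. continuous_map Y euclideanreal k \<and> (\<forall>y\<in>topspace Y. f y = k y * \<bar>f y\<bar>)"
    using continuous_map_compose [OF g k(1)] by blast
qed

lemma zero_dimensional_homeomorphic:
  assumes h: "homeomorphic_maps X Y e g" and X: "zero_dimensional_space X"
  shows "zero_dimensional_space Y"
proof -
  have e: "continuous_map X Y e" and g: "continuous_map Y X g"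
    and eg: "\<And>y. y \<in> topspace Y \<Longrightarrow> e (g y) = y"
    using h by (auto simp: homeomorphic_maps_def)
  have "t1_space Y"
    using X h homeomorphic_t1_space [of X Y] unfolding zero_dimensional_space_def homeomorphic_space_def
    by blast
  moreover have "\<exists>C. (openin Y C \<and> closedin Y C) \<and> y \<in> C \<and> C \<subseteq> U" if U: "openin Y U" "y \<in> U" for U y
  proof -
    have y: "y \<in> topspace Y"
      using U openin_subset by blast
    have "openin X {x \<in> topspace X. e x \<in> U}"
      using e U by (simp add: openin_continuous_map_preimage)
    moreover have "g y \<in> {x \<in> topspace X. e x \<in> U}"
      using g y U eg by (auto simp: continuous_map_def)
    ultimately obtain C where C: "openin X C" "closedin X C" "g y \<in> C" "C \<subseteq> {x \<in> topspace X. e x \<in> U}"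
      by (rule zero_dimensional_base [OF X])
    let ?C = "{y \<in> topspace Y. g y \<in> C}"
    have "openin Y ?C" "closedin Y ?C"
      using C g by (auto simp: openin_continuous_map_preimage closedin_continuous_map_preimage)
    moreover have "?C \<subseteq> U"
      using C(4) eg by force
    ultimately show ?thesis
      using C(3) y by blast
  qed
  then have "openin Y U \<longleftrightarrow> (arbitrary union_of (\<lambda>C. openin Y C \<and> closedin Y C)) U" for U
    unfolding arbitrary_union_of_alt by (meson openin_subopen)
  ultimately show ?thesis
    unfolding zero_dimensional_space_def by blast
qed

lemma strongly_zero_dimensional_homeomorphic:
  assumes h: "homeomorphic_maps X Y e g" and X: "strongly_zero_dimensional X"
  shows "strongly_zero_dimensional Y"
  unfolding strongly_zero_dimensional_def
proof (intro allI impI, elim conjE)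
  fix A B assume AB: "A \<subseteq> topspace Y" "B \<subseteq> topspace Y" and "completely_separated Y A B"
  then obtain f where f: "continuous_map Y (top_of_set {-1..1::real}) f" "f ` A = {-1}" "f ` B = {1}"
    by (auto simp: completely_separated_def)
  have e: "continuous_map X Y e" and g: "continuous_map Y X g"
    and eg: "\<And>y. y \<in> topspace Y \<Longrightarrow> e (g y) = y"
    using h by (auto simp: homeomorphic_maps_def)
  have "(f \<circ> e) ` (g ` A) = f ` A" "(f \<circ> e) ` (g ` B) = f ` B"
    unfolding image_comp using AB eg by (auto intro!: image_cong simp: subset_iff)
  then have "completely_separated X (g ` A) (g ` B)"
    using continuous_map_compose [OF e f(1)] f unfolding completely_separated_def by metis
  moreover have "g ` A \<subseteq> topspace X" "g ` B \<subseteq> topspace X"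
    using AB g by (auto simp: continuous_map_def)
  ultimately have "\<exists>C. openin X C \<and> closedin X C \<and> g ` A \<subseteq> C \<and> C \<inter> g ` B = {}"
    using X by (simp only: strongly_zero_dimensional_def)
  then obtain C where "openin X C" "closedin X C" "g ` A \<subseteq> C" "C \<inter> g ` B = {}"
    by blast
  then show "\<exists>C. openin Y C \<and> closedin Y C \<and> A \<subseteq> C \<and> C \<inter> B = {}"
    using AB g
    by (intro exI [of _ "{y \<in> topspace Y. g y \<in> C}"])
      (auto simp: openin_continuous_map_preimage closedin_continuous_map_preimage)
qed

text \<open>Carries the plank from its own datatype into the prescribed large type: the topology is
  pulled back along the inverse on the range of \<open>e\<close>.\<close>

lemma homeomorphic_copy:
  assumes e: "inj e"
  obtains Y g where "homeomorphic_maps X Y e g"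
proof -
  define Y where "Y = pullback_topology (range e) (inv e) X"
  have top: "topspace Y = e ` topspace X"
    using e by (auto simp: Y_def topspace_pullback_topology)
  have "continuous_map Y X (inv e)"
    unfolding Y_def by (rule continuous_map_pullback [of X X "\<lambda>x. x", simplified comp_def]) simp
  moreover have "continuous_map X Y e"
    unfolding Y_def by (rule continuous_map_pullback') (use e in \<open>auto simp: comp_def\<close>)
  ultimately have "homeomorphic_maps X Y e (inv e)"
    using e by (auto simp: homeomorphic_maps_def top)
  then show thesis
    by (rule that)
qed

section \<open>The size of the space\<close>

lemma inj_pair_code: "\<exists>c :: nat set set \<times> nat set set \<Rightarrow> nat set set. inj c"
proof -
  have "|UNIV :: (nat set set \<times> nat set set) set| \<le>o |UNIV :: nat set set set|"
    using card_of_Times_same_infinite [of "UNIV :: nat set set set"] infinite_UNIV_nat_set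
    by (simp add: Finite_Set.finite_set ordIso_iff_ordLeq)
  then show ?thesis
    by (auto simp flip: card_of_ordLeq)
qed

lemma inj_filter_code: "\<exists>c :: (nat \<times> nat) filter \<Rightarrow> nat set set. inj c"
proof
  let ?c = "\<lambda>p. {E. eventually (\<lambda>d. prod_encode d \<in> E) p}"
  show "inj ?c"
  proof (rule injI)
    fix p q :: "(nat \<times> nat) filter" assume eq: "?c p = ?c q"
    have "eventually P p = eventually P q" for P
    proof -
      have "prod_encode ` {d. P d} \<in> ?c p \<longleftrightarrow> prod_encode ` {d. P d} \<in> ?c q"
        unfolding eq ..
      then show ?thesis
        by (simp add: inj_image_mem_iff [OF inj_prod_encode])
    qed
    then show "p = q"
      by (simp add: filter_eq_iff)
  qed
qed

lemma inj_point_code: "\<exists>e :: point \<Rightarrow> large_type. inj e"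
proof -
  obtain c :: "nat set set \<times> nat set set \<Rightarrow> nat set set" where c: "inj c"
    using inj_pair_code by blast
  obtain d :: "(nat \<times> nat) filter \<Rightarrow> nat set set" where d: "inj d"
    using inj_filter_code by blast
  \<comment> \<open>The distinct tags \<open>{}\<close>, \<open>{{}}\<close> and
    \<open>{{0}}\<close> keep the constructors apart, and \<open>{a}\<close> lifts \<open>a\<close>
    to the type of the codes.\<close>
  define k where "k x = (case x of
      Point a b p \<Rightarrow> c ({}, c (c ({a}, b), d p))
    | Row a p \<Rightarrow> c ({{}}, c ({a}, d p))
    | Column b p \<Rightarrow> c ({{0}}, c (b, d p)))" for x
  have "inj k"
    by (rule injI) (auto simp: k_def inj_eq [OF c] inj_eq [OF d] split: point.splits)
  \<comment> \<open>Three nested singletons lift the code from \<open>nat set set\<close> to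
    \<open>large_type\<close>.\<close>
  then have "inj (\<lambda>x. {{{k x}}})"
    by (simp add: inj_def)
  then show ?thesis
    by blast
qed

theorem mainTheorem1:
  shows "\<exists>X :: large_type topology.
           tychonoff_space X \<and> zero_dimensional_space X \<and> F_space X \<and>
           \<not> strongly_zero_dimensional X \<and>
           \<not> zero_dimensional_space (cech_stone X)"
proof -
  obtain e :: "point \<Rightarrow> large_type" where "inj e"
    using inj_point_code by blast
  then obtain X g where h: "homeomorphic_maps plank_topology X e g"
    by (rule homeomorphic_copy)
  have zd: "zero_dimensional_space X"
    using h zero_dimensional_plank by (rule zero_dimensional_homeomorphic)
  then have ty: "tychonoff_space X"
    by (rule zero_dimensional_imp_tychonoff)
  have "F_space X"
    using h F_space_plank by (rule F_space_homeomorphic)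
  moreover have "homeomorphic_maps X plank_topology g e"
    using h by (rule homeomorphic_maps_sym [THEN iffD1])
  then have "\<not> strongly_zero_dimensional X"
    using strongly_zero_dimensional_homeomorphic not_strongly_zero_dimensional_plank by blast
  ultimately show ?thesis
    using zd ty strongly_zero_dimensional_if_cech_stone by blast
qed

end
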